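(* Let $K\ge 2$ be an integer and let $\alpha,\beta>0$ be constants with $\sqrt{\alpha}-\sqrt{\beta}>\sqrt{K}$. Let $\bm{A}$ be the adjacency matrix of a realization of the random graph generated according to the symmetric SBM with parameters $(n,K,p,q)$ and a planted partition $\bm{H}^*\in\mathbb{H}_{n,K}$, where $p=\alpha\log n/n$ and $q=\beta\log n/n$, and suppose that $n$ is sufficiently large. Then there exists a constant $\gamma>0$, whose value depends only on $\alpha$, $\beta$ and $K$, such that the following statement holds with probability at least $1-n^{-\Omega(1)}$: if the initial point $\bm{H}^0\in\mathbb{M}_{n,K}$ satisfies $$\min_{\bm{Q}\in\Pi_K}\|\bm{H}^0-\bm{H}^*\bm{Q}\|_F\le\theta\sqrt{n},\qquad \theta=\frac14\min\left\{\frac{1}{\sqrt{K}},\frac{\gamma\sqrt{K}}{16(\alpha-\beta)}\right\},$$ then the projected power method outputs a true partition in $$N_0=\lceil 2\log\log n\rceil+\left\lceil\frac{2\log n}{\log\log n}\right\rceil+2$$ projected power iterations; i.e., run with $N=N_0$, its output satisfies $\bm{H}^{N+1}=\bm{H}^*\bm{Q}$ for some $\bm{Q}\in\Pi_K$.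
   Context: Throughout, $n=mK$ with $m$ a positive integer, $\|\cdot\|_F$ is the Frobenius norm, $[n]=\{1,\dots,n\}$, $\bm{1}_d$ is the all-one vector in $\mathbb{R}^d$, and $\Pi_K$ is the set of all $K\times K$ permutation matrices. Clustering matrices: $\bm{H}\in\mathbb{R}^{n\times K}$ is a clustering matrix if there are pairwise disjoint sets $\mathcal{I}_1,\dots,\mathcal{I}_K$ with $\bigcup_k\mathcal{I}_k=[n]$ such that $h_{ik}=1$ if $i\in\mathcal{I}_k$ and $h_{ik}=0$ otherwise; it is balanced if in addition $|\mathcal{I}_k|=m$ for all $k$. $\mathbb{M}_{n,K}$ and $\mathbb{H}_{n,K}$ denote the sets of all clustering matrices and of all balanced clustering matrices, respectively. Symmetric SBM with parameters $(n,K,p,q)$ and planted partition $\bm{H}^*\in\mathbb{H}_{n,K}$: a random graph on $[n]$ whose symmetric adjacency matrix $\bm{A}=(a_{ij})$ has independent entries $\{a_{ij}\}_{1\le i\le j\le n}$ (diagonal included), with $a_{ij}\sim\mathrm{Bernoulli}(p)$ if rows $i$ and $j$ of $\bm{H}^*$ are equal (same community) and $a_{ij}\sim\mathrm{Bernoulli}(q)$ otherwise. A true partition is any $\bm{H}^*\bm{Q}$ with $\bm{Q}\in\Pi_K$. Projection: $\mathcal{H}=\{\bm{H}\in\{0,1\}^{n\times K}:\bm{H}\bm{1}_K=\bm{1}_n,\ \bm{H}^T\bm{1}_n=m\bm{1}_K\}$, and for $\bm{C}\in\mathbb{R}^{n\times K}$, $\mathcal{T}(\bm{C})=\operatorname{argmin}\{\|\bm{H}-\bm{C}\|_F:\bm{H}\in\mathcal{H}\}$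 (the set of all minimizers). Projected power method with input $\bm{A}$, a positive integer $N$ and an initial point $\bm{H}^0$: choose any $\bm{H}^1\in\mathcal{T}(\bm{H}^0)$; for $k=1,\dots,N$ choose any $\bm{H}^{k+1}\in\mathcal{T}(\bm{A}\bm{H}^k)$; output $\bm{H}^{N+1}$. "With probability at least $1-n^{-\Omega(1)}$" means: with probability at least $1-n^{-c}$ for a constant $c>0$ depending only on $\alpha,\beta,K$, for all $n$ larger than a constant depending only on $\alpha,\beta,K$. *)

theory Defs
  imports
    "HOL-Probability.Probability"
    "HOL-Combinatorics.Permutations"
    "Jordan_Normal_Form.Matrix"
begin

text \<open>
  Matrices are those of Jordan_Normal_Form, whose dimensions are values, so that
  constants can be chosen before \<open>n\<close>.  Indices are 0-based: \<open>{..<n}\<close> plays the role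
  of \<open>{1, \<dots>, n}\<close>.  Throughout, \<open>n = m * K\<close>.
\<close>

definition frob_norm :: "real mat \<Rightarrow> real" where
  "frob_norm M = sqrt (\<Sum>i<dim_row M. \<Sum>j<dim_col M. (M $$ (i, j))\<^sup>2)"

definition ones_vec :: "nat \<Rightarrow> real vec" where
  "ones_vec d = vec d (\<lambda>_. 1)"

definition perm_mats :: "nat \<Rightarrow> real mat set" where
  "perm_mats K = {mat K K (\<lambda>(i, j). if \<pi> i = j then 1 else 0) | \<pi>. \<pi> permutes {..<K}}"

text \<open>This makes the minimum over permutation matrices well defined.\<close>

lemma finite_perm_mats: "finite (perm_mats K)"
  and perm_mats_nonempty: "perm_mats K \<noteq> {}"
proof -
  have eq: "perm_mats K =
    (\<lambda>\<pi>. mat K K (\<lambda>(i, j). if \<pi> i = j then 1 else 0)) ` {\<pi>. \<pi> permutes {..<K}}"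
    by (auto simp: perm_mats_def)
  show "finite (perm_mats K)"
    unfolding eq by (intro finite_imageI finite_permutations) simp
  show "perm_mats K \<noteq> {}"
    unfolding eq using permutes_id by blast
qed

definition is_partition :: "nat \<Rightarrow> nat \<Rightarrow> (nat \<Rightarrow> nat set) \<Rightarrow> bool" where
  "is_partition n K I \<longleftrightarrow> disjoint_family_on I {..<K} \<and> (\<Union>k<K. I k) = {..<n}"

definition membership_mat :: "nat \<Rightarrow> nat \<Rightarrow> (nat \<Rightarrow> nat set) \<Rightarrow> real mat" where
  "membership_mat n K I = mat n K (\<lambda>(i, k). if i \<in> I k then 1 else 0)"

text \<open>As in the definition being formalised, clusters are allowed to be empty here.\<close>

definition clustering_mats :: "nat \<Rightarrow> nat \<Rightarrow> real mat set" where
  "clustering_mats n K = {membership_mat n K I | I. is_partition n K I}"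

definition balanced_clustering_mats :: "nat \<Rightarrow> nat \<Rightarrow> real mat set" where
  "balanced_clustering_mats m K =
     {membership_mat (m * K) K I | I. is_partition (m * K) K I \<and> (\<forall>k<K. card (I k) = m)}"

text \<open>
  Distribution of the adjacency matrix.  The independent entries are those with
  \<open>i \<le> j\<close>, diagonal included; the entry at \<open>(i, j)\<close> of the symmetric matrix is read off
  at the ordered pair.  \<open>bernoulli_pmf\<close> clamps its parameter to
  \<open>[0, 1]\<close>, which has no effect when \<open>p\<close> and \<open>q\<close> are probabilities.
\<close>

definition sbm :: "nat \<Rightarrow> real \<Rightarrow> real \<Rightarrow> real mat \<Rightarrow> real mat pmf" where
  "sbm n p q Hs =
     map_pmf (\<lambda>\<omega>. mat n n (\<lambda>(i, j). if \<omega> (min i j, max i j) then 1 else 0))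
       (Pi_pmf {(i, j). i \<le> j \<and> j < n} False
          (\<lambda>(i, j). bernoulli_pmf (if row Hs i = row Hs j then p else q)))"

definition feasible_mats :: "nat \<Rightarrow> nat \<Rightarrow> real mat set" where
  "feasible_mats m K =
     {H \<in> carrier_mat (m * K) K. elements_mat H \<subseteq> {0, 1} \<and>
        H *\<^sub>v ones_vec K = ones_vec (m * K) \<and>
        transpose_mat H *\<^sub>v ones_vec (m * K) = real m \<cdot>\<^sub>v ones_vec K}"

definition proj :: "nat \<Rightarrow> nat \<Rightarrow> real mat \<Rightarrow> real mat set" where
  "proj m K C = {H. is_arg_min (\<lambda>H. frob_norm (H - C)) (\<lambda>H. H \<in> feasible_mats m K) H}"

text \<open>
  Projections need not be unique, so the method is the set of its possible outputs:
  one for every admissible sequence of choices.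
\<close>

definition ppm_outputs :: "nat \<Rightarrow> nat \<Rightarrow> real mat \<Rightarrow> nat \<Rightarrow> real mat \<Rightarrow> real mat set" where
  "ppm_outputs m K A N H0 =
     {X (N + 1) | X. X 1 \<in> proj m K H0 \<and> (\<forall>k\<in>{1..N}. X (k + 1) \<in> proj m K (A * X k))}"

definition true_partitions :: "nat \<Rightarrow> real mat \<Rightarrow> real mat set" where
  "true_partitions K Hs = {Hs * Q | Q. Q \<in> perm_mats K}"

definition theta :: "real \<Rightarrow> real \<Rightarrow> nat \<Rightarrow> real \<Rightarrow> real" where
  "theta \<alpha> \<beta> K \<gamma> = 1 / 4 * min (1 / sqrt (real K)) (\<gamma> * sqrt (real K) / (16 * (\<alpha> - \<beta>)))"

text \<open>The conversions to \<open>nat\<close> are harmless: both ceilings are nonnegative once \<open>n \<ge> 16\<close>.\<close>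

definition num_iterations :: "nat \<Rightarrow> nat" where
  "num_iterations n =
     nat \<lceil>2 * ln (ln (real n))\<rceil> + nat \<lceil>2 * ln (real n) / ln (ln (real n))\<rceil> + 2"

end

theory Submission
  imports Defs "HOL-Real_Asymp.Real_Asymp"
begin

text \<open>
  Identify a clustering matrix with its labelling, so that squared Frobenius distances count
  mislabelled vertices.  Let \<open>L = ln n\<close>, and let \<open>T\<close> and \<open>S\<close> be the mislabelled sets before and
  after an iteration.  With high probability each vertex has at least \<open>g * L\<close> more neighbours in
  its own community than in any other one, and then optimality of the projection yields
  \<open>g * L * card S \<le> 2 * e(S, T)\<close>, where \<open>e(S, T)\<close> is the sum of the adjacency entries over
  \<open>S \<times> T\<close>.  A Chernoff bound and a union bound over all pairs of sets show that, with high
  probability, this inequality fails whenever \<open>T\<close> contains at most a small fixed proportion of the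
  vertices and \<open>card T \<le> sqrt L * card S\<close>.  Hence every iteration divides the number of
  mislabelled vertices by \<open>sqrt L\<close>, and \<open>2 * L / ln L\<close> iterations bring it below one.
  The constant \<open>\<gamma>\<close> is free, so it is chosen to place the initial point in this small regime.

  The separation of the degrees has a Chernoff exponent \<open>(sqrt \<alpha> - sqrt \<beta>)\<^sup>2 / K > 1\<close>, which beats
  the union bound over the vertices.
\<close>

section \<open>Labellings and clustering matrices\<close>

text \<open>A label outside \<open>{..<K}\<close> would give a zero row, hence the recurring
  assumption \<open>g i < K\<close>.\<close>

definition label_mat :: "nat \<Rightarrow> nat \<Rightarrow> (nat \<Rightarrow> nat) \<Rightarrow> real mat" where
  "label_mat n K g = mat n K (\<lambda>(i, k). if g i = k then 1 else 0)"

definition balanced_label :: "nat \<Rightarrow> nat \<Rightarrow> (nat \<Rightarrow> nat) \<Rightarrow> bool" where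
  "balanced_label m K g \<longleftrightarrow>
     (\<forall>i<m * K. g i < K) \<and> (\<forall>k<K. card {i. i < m * K \<and> g i = k} = m)"

definition mismatch :: "nat \<Rightarrow> (nat \<Rightarrow> nat) \<Rightarrow> (nat \<Rightarrow> nat) \<Rightarrow> nat set" where
  "mismatch n f g = {i. i < n \<and> f i \<noteq> g i}"

lemma finite_mismatch [simp]: "finite (mismatch n f g)"
  by (simp add: mismatch_def)

lemma mismatch_commute: "mismatch n f g = mismatch n g f"
  by (auto simp: mismatch_def)

lemma label_mat_dim [simp]:
  "dim_row (label_mat n K g) = n" "dim_col (label_mat n K g) = K"
  by (simp_all add: label_mat_def)

lemma label_mat_index [simp]:
  "i < n \<Longrightarrow> k < K \<Longrightarrow> label_mat n K g $$ (i, k) = (if g i = k then 1 else 0)"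
  by (simp add: label_mat_def)

lemma label_mat_carrier [simp]: "label_mat n K g \<in> carrier_mat n K"
  by (simp add: label_mat_def)

lemma label_mat_cong:
  assumes "\<And>i. i < n \<Longrightarrow> g i = h i"
  shows "label_mat n K g = label_mat n K h"
  using assms by (intro eq_matI) auto

text \<open>Disjointness makes the part containing a vertex unique, so its index can serve as the
  label of the vertex.\<close>

lemma membership_mat_label:
  assumes "is_partition n K I"
  obtains g where "membership_mat n K I = label_mat n K g"
    and "\<And>i. i < n \<Longrightarrow> g i < K"
    and "\<And>k. k < K \<Longrightarrow> {i. i < n \<and> g i = k} = I k"
proof -
  have cover: "(\<Union>k<K. I k) = {..<n}" and disj: "disjoint_family_on I {..<K}"
    using assms by (auto simp: is_partition_def)
  have "\<exists>k<K. i \<in> I k" if "i < n" for i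
    using that cover by (metis UN_E lessThan_iff)
  then obtain g where g: "\<And>i. i < n \<Longrightarrow> g i < K \<and> i \<in> I (g i)"
    by metis
  have uniq: "g i = k \<longleftrightarrow> i \<in> I k" if "i < n" "k < K" for i k
  proof
    assume "i \<in> I k"
    then have "i \<in> I (g i) \<inter> I k" using g[OF that(1)] by blast
    then show "g i = k"
      using disj g[OF that(1)] that(2) unfolding disjoint_family_on_def by (metis empty_iff lessThan_iff)
  qed (use g[OF that(1)] in blast)
  have sub: "I k \<subseteq> {..<n}" if "k < K" for k
    using cover that by blast
  show ?thesis
  proof
    show "membership_mat n K I = label_mat n K g"
      by (intro eq_matI) (auto simp: membership_mat_def uniq)
    show "\<And>i. i < n \<Longrightarrow> g i < K" using g by blast
    show "{i. i < n \<and> g i = k} = I k" if "k < K" for k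
      using uniq[OF _ that] sub[OF that] by auto
  qed
qed

lemma clustering_mats_label:
  assumes "H \<in> clustering_mats n K"
  obtains g where "H = label_mat n K g" "\<And>i. i < n \<Longrightarrow> g i < K"
proof -
  obtain I where I: "H = membership_mat n K I" "is_partition n K I"
    using assms by (auto simp: clustering_mats_def)
  show ?thesis
  proof (rule membership_mat_label[OF I(2)])
    fix g assume "membership_mat n K I = label_mat n K g" and "\<And>i. i < n \<Longrightarrow> g i < K"
    then show ?thesis
      by (intro that[of g]) (simp_all add: I(1))
  qed
qed

lemma balanced_clustering_mats_label:
  assumes "H \<in> balanced_clustering_mats m K"
  obtains g where "H = label_mat (m * K) K g" "balanced_label m K g"
proof -
  obtain I where I: "H = membership_mat (m * K) K I" "is_partition (m * K) K I"
    "\<And>k. k < K \<Longrightarrow> card (I k) = m"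
    using assms by (auto simp: balanced_clustering_mats_def)
  show ?thesis
  proof (rule membership_mat_label[OF I(2)])
    fix g assume "membership_mat (m * K) K I = label_mat (m * K) K g"
      and "\<And>i. i < m * K \<Longrightarrow> g i < K"
      and "\<And>k. k < K \<Longrightarrow> {i. i < m * K \<and> g i = k} = I k"
    then show ?thesis
      by (intro that[of g]) (simp_all add: I(1,3) balanced_label_def)
  qed
qed

lemma sum_indicator_eq_card:
  "(\<Sum>i<(n::nat). if P i then 1 else 0 :: real) = real (card {i. i < n \<and> P i})"
  by (simp add: sum.If_cases Int_def)

lemma label_mat_feasible:
  assumes "balanced_label m K g"
  shows "label_mat (m * K) K g \<in> feasible_mats m K"
proof -
  let ?H = "label_mat (m * K) K g"
  have g: "g i < K" if "i < m * K" for i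
    using assms that by (auto simp: balanced_label_def)
  have 1: "elements_mat ?H \<subseteq> {0, 1}"
    by (auto simp: elements_mat_def)
  have 2: "?H *\<^sub>v ones_vec K = ones_vec (m * K)"
    by (intro eq_vecI) (auto simp: ones_vec_def scalar_prod_def lessThan_atLeast0[symmetric] g)
  have 3: "transpose_mat ?H *\<^sub>v ones_vec (m * K) = real m \<cdot>\<^sub>v ones_vec K"
  proof (intro eq_vecI)
    fix k assume "k < dim_vec (real m \<cdot>\<^sub>v ones_vec K)"
    then have k: "k < K" by (simp add: ones_vec_def)
    have "(transpose_mat ?H *\<^sub>v ones_vec (m * K)) $ k = (\<Sum>i<m * K. if g i = k then 1 else 0)"
      using k by (auto simp: ones_vec_def scalar_prod_def lessThan_atLeast0[symmetric] intro!: sum.cong)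
    also have "\<dots> = real m"
      using assms k by (simp only: sum_indicator_eq_card) (auto simp: balanced_label_def)
    finally show "(transpose_mat ?H *\<^sub>v ones_vec (m * K)) $ k = (real m \<cdot>\<^sub>v ones_vec K) $ k"
      using k by (simp add: ones_vec_def)
  qed (simp add: ones_vec_def)
  show ?thesis using 1 2 3 by (simp add: feasible_mats_def)
qed

text \<open>A 0/1 row with sum 1 has exactly one 1, whose column is the label; the column sums then
  give the community sizes.\<close>

lemma feasible_mats_label:
  assumes "H \<in> feasible_mats m K"
  obtains g where "H = label_mat (m * K) K g" "balanced_label m K g"
proof -
  have car: "H \<in> carrier_mat (m * K) K" and el: "elements_mat H \<subseteq> {0, 1}"
    and r: "H *\<^sub>v ones_vec K = ones_vec (m * K)"
    and c: "transpose_mat H *\<^sub>v ones_vec (m * K) = real m \<cdot>\<^sub>v ones_vec K"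
    using assms by (auto simp: feasible_mats_def)
  have dims: "dim_row H = m * K" "dim_col H = K" using car by auto
  have bin: "H $$ (i, k) = 0 \<or> H $$ (i, k) = 1" if "i < m * K" "k < K" for i k
    using el that dims unfolding elements_mat_def by fastforce
  have row: "card {k. k < K \<and> H $$ (i, k) = 1} = 1" if i: "i < m * K" for i
  proof -
    have "real (card {k. k < K \<and> H $$ (i, k) = 1}) = (\<Sum>k<K. if H $$ (i, k) = 1 then 1 else 0)"
      by (simp only: sum_indicator_eq_card)
    also have "\<dots> = (\<Sum>k<K. H $$ (i, k))"
      using bin[OF i] by (intro sum.cong) auto
    also have "\<dots> = (H *\<^sub>v ones_vec K) $ i"
      using i dims by (auto simp: ones_vec_def scalar_prod_def lessThan_atLeast0[symmetric] intro!: sum.cong)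
    also have "\<dots> = 1" using r i by (simp add: ones_vec_def)
    finally show ?thesis by simp
  qed
  have "\<exists>k0. {k. k < K \<and> H $$ (i, k) = 1} = {k0}" if "i < m * K" for i
    using row[OF that] by (simp add: card_1_singleton_iff)
  then obtain g where g: "\<And>i. i < m * K \<Longrightarrow> {k. k < K \<and> H $$ (i, k) = 1} = {g i}"
    by metis
  have gK: "g i < K" if "i < m * K" for i
    using g[OF that] by blast
  have Hg: "H $$ (i, k) = (if g i = k then 1 else 0)" if "i < m * K" "k < K" for i k
  proof -
    have "k \<in> {k. k < K \<and> H $$ (i, k) = 1} \<longleftrightarrow> g i = k"
      unfolding g[OF that(1)] by auto
    then show ?thesis using bin[OF that] that(2) by auto
  qed
  have eq: "H = label_mat (m * K) K g"
    using dims by (intro eq_matI) (auto simp: Hg)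
  have "card {i. i < m * K \<and> g i = k} = m" if k: "k < K" for k
  proof -
    have "real (card {i. i < m * K \<and> g i = k}) = (\<Sum>i<m * K. if g i = k then 1 else 0)"
      by (simp only: sum_indicator_eq_card)
    also have "\<dots> = (transpose_mat H *\<^sub>v ones_vec (m * K)) $ k"
      using k dims Hg by (auto simp: ones_vec_def scalar_prod_def lessThan_atLeast0[symmetric] intro!: sum.cong)
    also have "\<dots> = real m" using c k by (simp add: ones_vec_def)
    finally show ?thesis by simp
  qed
  then show ?thesis using that[OF eq] gK by (auto simp: balanced_label_def)
qed

text \<open>The permutation matrix has the 1 of row \<open>k\<close> in column
  \<open>\<pi> k\<close>, so multiplying by it on the right renames label \<open>k\<close> to
  \<open>\<pi> k\<close>. The true partitions are thus the renamings of the planted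
  labelling.\<close>

lemma label_mat_mult_perm:
  assumes "\<pi> permutes {..<K}" and "\<And>i. i < n \<Longrightarrow> f i < K"
  shows "label_mat n K f * mat K K (\<lambda>(i, j). if \<pi> i = j then 1 else 0) = label_mat n K (\<pi> \<circ> f)"
proof (rule eq_matI)
  fix i j assume "i < dim_row (label_mat n K (\<pi> \<circ> f))" "j < dim_col (label_mat n K (\<pi> \<circ> f))"
  then have ij: "i < n" "j < K" by auto
  have "(label_mat n K f * mat K K (\<lambda>(i, j). if \<pi> i = j then 1 else 0)) $$ (i, j)
      = (\<Sum>k<K. (if f i = k then (if \<pi> k = j then 1 else 0) else 0))"
    using ij by (simp add: scalar_prod_def lessThan_atLeast0[symmetric] if_distribR mult_if_delta
        del: sum.delta sum.delta')
  also have "\<dots> = (if \<pi> (f i) = j then 1 else 0)"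
    using assms(2) ij by (simp add: sum.delta')
  finally show "(label_mat n K f * mat K K (\<lambda>(i, j). if \<pi> i = j then 1 else 0)) $$ (i, j)
      = label_mat n K (\<pi> \<circ> f) $$ (i, j)"
    using ij by simp
qed auto

lemma balanced_label_permute:
  assumes "\<pi> permutes {..<K}" and "balanced_label m K f"
  shows "balanced_label m K (\<pi> \<circ> f)"
proof -
  have "{i. i < m * K \<and> (\<pi> \<circ> f) i = k} = {i. i < m * K \<and> f i = inv_into UNIV \<pi> k}" if "k < K" for k
    using permutes_inverses[OF assms(1)] by auto
  moreover have "inv_into UNIV \<pi> k < K" if "k < K" for k
    using permutes_in_image[OF permutes_inv[OF assms(1)], of k] that by simp
  moreover have "\<pi> k < K" if "k < K" for k
    using permutes_in_image[OF assms(1), of k] that by simp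
  ultimately show ?thesis using assms(2) by (auto simp: balanced_label_def)
qed

section \<open>Frobenius distances and the projection\<close>

lemma frob_norm_nonneg [simp]: "frob_norm M \<ge> 0"
  by (simp add: frob_norm_def sum_nonneg)

text \<open>Each row of the labelling matrix has a single 1, so the labelling enters only through
  the linear term. Minimising the distance over balanced labellings therefore means maximising that
  term.\<close>

lemma frob_norm_label_diff:
  assumes "C \<in> carrier_mat n K" and "\<And>i. i < n \<Longrightarrow> g i < K"
  shows "(frob_norm (label_mat n K g - C))\<^sup>2 =
    real n - 2 * (\<Sum>i<n. C $$ (i, g i)) + (\<Sum>i<n. \<Sum>k<K. (C $$ (i, k))\<^sup>2)"
proof -
  have "(frob_norm (label_mat n K g - C))\<^sup>2 =
      (\<Sum>i<n. \<Sum>k<K. ((if g i = k then 1 else 0) - C $$ (i, k))\<^sup>2)"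
    using assms(1) by (simp add: frob_norm_def sum_nonneg)
  also have "\<dots> = (\<Sum>i<n. (1 - 2 * C $$ (i, g i)) + (\<Sum>k<K. (C $$ (i, k))\<^sup>2))"
  proof (rule sum.cong[OF refl])
    fix i assume "i \<in> {..<n}"
    then have gi: "g i < K" using assms(2) by simp
    have "(\<Sum>k<K. ((if g i = k then 1 else 0) - C $$ (i, k))\<^sup>2)
        = (\<Sum>k<K. (if g i = k then 1 - 2 * C $$ (i, k) else 0) + (C $$ (i, k))\<^sup>2)"
      by (intro sum.cong) (auto simp: power2_eq_square algebra_simps)
    also have "\<dots> = (1 - 2 * C $$ (i, g i)) + (\<Sum>k<K. (C $$ (i, k))\<^sup>2)"
      using gi by (simp add: sum.distrib)
    finally show "(\<Sum>k<K. ((if g i = k then 1 else 0) - C $$ (i, k))\<^sup>2) =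
      (1 - 2 * C $$ (i, g i)) + (\<Sum>k<K. (C $$ (i, k))\<^sup>2)" .
  qed
  also have "\<dots> = real n - 2 * (\<Sum>i<n. C $$ (i, g i)) + (\<Sum>i<n. \<Sum>k<K. (C $$ (i, k))\<^sup>2)"
    by (simp add: sum.distrib sum_subtractf sum_distrib_left)
  finally show ?thesis .
qed

text \<open>This is the expansion with \<open>C\<close> itself a labelling matrix: its rows have
  norm 1 and the linear term counts the agreements. A mislabelled row differs in two entries, whence
  the factor 2.\<close>

lemma frob_norm_label_mismatch:
  assumes "\<And>i. i < n \<Longrightarrow> g i < K" and "\<And>i. i < n \<Longrightarrow> h i < K"
  shows "(frob_norm (label_mat n K g - label_mat n K h))\<^sup>2 = 2 * real (card (mismatch n g h))"
proof -
  have "(\<Sum>i<n. label_mat n K h $$ (i, g i)) = (\<Sum>i<n. if g i = h i then 1 else 0)"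
    using assms by (intro sum.cong) auto
  also have "\<dots> = (\<Sum>i<n. 1 - (if g i \<noteq> h i then 1 else 0))"
    by (intro sum.cong) auto
  also have "\<dots> = real n - real (card (mismatch n g h))"
    by (simp only: sum_subtractf sum_indicator_eq_card mismatch_def) simp
  finally have 1: "(\<Sum>i<n. label_mat n K h $$ (i, g i)) = real n - real (card (mismatch n g h))" .
  have "(\<Sum>k<K. (label_mat n K h $$ (i, k))\<^sup>2) = 1" if "i < n" for i
  proof -
    have "(\<Sum>k<K. (label_mat n K h $$ (i, k))\<^sup>2) = (\<Sum>k<K. if h i = k then 1 else 0)"
      using that by (intro sum.cong) auto
    then show ?thesis using assms(2)[OF that] by simp
  qed
  then have "(\<Sum>i<n. \<Sum>k<K. (label_mat n K h $$ (i, k))\<^sup>2) = real n" by simp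
  then show ?thesis
    using frob_norm_label_diff[OF label_mat_carrier[of n K h] assms(1)] 1 by simp
qed

lemma proj_label:
  assumes "X \<in> proj m K C" 
  obtains g where "X = label_mat (m * K) K g" "balanced_label m K g"
proof -
  have "X \<in> feasible_mats m K"
    using assms by (auto simp: proj_def is_arg_min_def)
  then show ?thesis using feasible_mats_label that by metis
qed

lemma proj_minimal:
  assumes "X \<in> proj m K C" "balanced_label m K f"
  shows "frob_norm (X - C) \<le> frob_norm (label_mat (m * K) K f - C)"
  using assms label_mat_feasible[OF assms(2)] by (auto simp: proj_def is_arg_min_linorder)

text \<open>Optimality of the projection in linear form: the terms of the expansion that do not
  involve the labelling cancel.\<close>

lemma proj_sum_le:
  assumes "label_mat (m * K) K g \<in> proj m K C" "C \<in> carrier_mat (m * K) K"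
    and "balanced_label m K f" "balanced_label m K g"
  shows "(\<Sum>i<m * K. C $$ (i, f i)) \<le> (\<Sum>i<m * K. C $$ (i, g i))"
proof -
  have "(frob_norm (label_mat (m * K) K g - C))\<^sup>2 \<le> (frob_norm (label_mat (m * K) K f - C))\<^sup>2"
    using proj_minimal[OF assms(1,3)] by (intro power_mono) auto
  then show ?thesis
    using assms(3,4)
    by (simp add: frob_norm_label_diff[OF assms(2)] balanced_label_def del: power_mono_iff)
qed

lemma mismatch_triangle:
  "card (mismatch n f h) \<le> card (mismatch n f g) + card (mismatch n g h)"
proof -
  have "mismatch n f h \<subseteq> mismatch n f g \<union> mismatch n g h"
    by (auto simp: mismatch_def)
  then have "card (mismatch n f h) \<le> card (mismatch n f g \<union> mismatch n g h)"
    by (intro card_mono) auto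
  also have "\<dots> \<le> card (mismatch n f g) + card (mismatch n g h)"
    by (rule card_Un_le)
  finally show ?thesis .
qed

text \<open>The labelling \<open>f\<close> competes in the projection, so \<open>g\<close> is no
  farther from \<open>h\<close> than \<open>f\<close> is; the triangle inequality then gives the
  factor 2.\<close>

lemma proj_initial_mismatch:
  assumes "label_mat (m * K) K g \<in> proj m K (label_mat (m * K) K h)"
    and "balanced_label m K f" "balanced_label m K g" "\<And>i. i < m * K \<Longrightarrow> h i < K"
  shows "card (mismatch (m * K) g f) \<le> 2 * card (mismatch (m * K) h f)"
proof -
  have "(frob_norm (label_mat (m * K) K g - label_mat (m * K) K h))\<^sup>2
      \<le> (frob_norm (label_mat (m * K) K f - label_mat (m * K) K h))\<^sup>2"
    using proj_minimal[OF assms(1,2)] by (intro power_mono) auto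
  then have "card (mismatch (m * K) g h) \<le> card (mismatch (m * K) f h)"
    using assms(2-4)
    by (simp add: frob_norm_label_mismatch balanced_label_def del: power_mono_iff)
  then show ?thesis
    using mismatch_triangle[of "m * K" g f h] by (simp add: mismatch_commute[of _ f h])
qed

section \<open>Deterministic analysis of the iteration\<close>

text \<open>Replacing the current labels \<open>h\<close> by the true ones \<open>f\<close> only alters the columns in
  the mismatch set \<open>T\<close>, so the separation of the degrees under \<open>f\<close> forces many edges between
  the next mismatch set \<open>S\<close> and \<open>T\<close>.\<close>

lemma ppm_step_mismatch_edges:
  fixes a :: "nat \<Rightarrow> nat \<Rightarrow> real"
  assumes nonneg: "\<And>i j. a i j \<ge> 0"
    and gap: "\<And>i k. i < n \<Longrightarrow> k < K \<Longrightarrow> k \<noteq> f i \<Longrightarrow>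
      \<Gamma> \<le> (\<Sum>j<n. a i j * (of_bool (f j = f i) - of_bool (f j = k)))"
    and g: "\<And>i. i < n \<Longrightarrow> g i < K"
    and opt: "(\<Sum>i<n. \<Sum>j<n. a i j * of_bool (h j = f i)) \<le>
      (\<Sum>i<n. \<Sum>j<n. a i j * of_bool (h j = g i))"
  shows "\<Gamma> * card (mismatch n g f) \<le>
    2 * (\<Sum>i\<in>mismatch n g f. \<Sum>j\<in>mismatch n h f. a i j)"
proof -
  let ?S = "mismatch n g f" and ?T = "mismatch n h f"
  have "0 \<le> (\<Sum>i<n. \<Sum>j<n. a i j * (of_bool (h j = g i) - of_bool (h j = f i)))"
    using opt by (simp add: right_diff_distrib sum_subtractf)
  also have "\<dots> = (\<Sum>i\<in>?S. \<Sum>j<n. a i j * (of_bool (h j = g i) - of_bool (h j = f i)))"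
    by (rule sum.mono_neutral_right) (auto simp: mismatch_def)
  also have "\<dots> \<le> (\<Sum>i\<in>?S. 2 * (\<Sum>j\<in>?T. a i j) - \<Gamma>)"
  proof (rule sum_mono)
    fix i assume "i \<in> ?S"
    then have i: "i < n" "g i \<noteq> f i" by (auto simp: mismatch_def)
    \<comment> \<open>Termwise comparison: where \<open>h j = f j\<close> both sides agree, and
      elsewhere each of the two differences of indicators is at most 1, which accounts for the
      factor 2.\<close>
    have "(\<Sum>j<n. a i j * (of_bool (h j = g i) - of_bool (h j = f i))) \<le>
        (\<Sum>j<n. 2 * (if h j \<noteq> f j then a i j else 0)
           - a i j * (of_bool (f j = f i) - of_bool (f j = g i)))"
      using nonneg i by (intro sum_mono) (auto simp: of_bool_def)
    also have "\<dots> = 2 * (\<Sum>j<n. if h j \<noteq> f j then a i j else 0)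
           - (\<Sum>j<n. a i j * (of_bool (f j = f i) - of_bool (f j = g i)))"
      by (simp add: sum_subtractf sum_distrib_left)
    also have "(\<Sum>j<n. if h j \<noteq> f j then a i j else 0) = (\<Sum>j\<in>?T. a i j)"
      unfolding mismatch_def by (subst sum.inter_filter[symmetric]) (auto intro!: sum.cong)
    also have "2 * (\<Sum>j\<in>?T. a i j) - (\<Sum>j<n. a i j * (of_bool (f j = f i) - of_bool (f j = g i)))
       \<le> 2 * (\<Sum>j\<in>?T. a i j) - \<Gamma>"
      using gap[OF i(1) g[OF i(1)] i(2)] by linarith
    finally show "(\<Sum>j<n. a i j * (of_bool (h j = g i) - of_bool (h j = f i))) \<le>
      2 * (\<Sum>j\<in>?T. a i j) - \<Gamma>" .
  qed
  also have "\<dots> = 2 * (\<Sum>i\<in>?S. \<Sum>j\<in>?T. a i j) - \<Gamma> * card ?S"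
    by (simp add: sum_subtractf sum_distrib_left)
  finally show ?thesis by simp
qed


lemma mat_mult_label_index:
  assumes "i < n" "k < K"
  shows "(mat n n (\<lambda>(i, j). a i j) * label_mat n K h) $$ (i, k) =
    (\<Sum>j<n. a i j * of_bool (h j = k :: bool) :: real)"
  using assms
  by (auto simp: scalar_prod_def lessThan_atLeast0[symmetric] of_bool_def intro!: sum.cong)

text \<open>By contradiction: if the new mismatch set \<open>S\<close> were too large compared with
  the old one \<open>T\<close>, then \<open>S\<close> would be nonempty with
  \<open>card T <= r * card S\<close>, and \<open>sparse\<close> would put the edges between them
  strictly below the lower bound of \<open>ppm_step_mismatch_edges\<close>.\<close>

lemma ppm_step_contraction:
  fixes a :: "nat \<Rightarrow> nat \<Rightarrow> real" and m n K :: nat and \<Gamma> \<epsilon> r :: real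
  assumes n_def: "n = m * K"
    and nonneg: "\<And>i j. a i j \<ge> 0"
    and gap: "\<And>i k. i < n \<Longrightarrow> k < K \<Longrightarrow> k \<noteq> f i \<Longrightarrow>
      \<Gamma> \<le> (\<Sum>j<n. a i j * (of_bool (f j = f i) - of_bool (f j = k)))"
    and sparse: "\<And>S T. S \<subseteq> {..<n} \<Longrightarrow> T \<subseteq> {..<n} \<Longrightarrow> S \<noteq> {} \<Longrightarrow>
      real (card T) \<le> \<epsilon> * n \<Longrightarrow> real (card T) \<le> r * card S \<Longrightarrow>
      2 * (\<Sum>i\<in>S. \<Sum>j\<in>T. a i j) < \<Gamma> * card S"
    and f: "balanced_label m K f" and h: "real (card (mismatch n h f)) \<le> \<epsilon> * n"
    and X: "X \<in> proj m K (mat n n (\<lambda>(i, j). a i j) * label_mat n K h)"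
  obtains g where "X = label_mat n K g" "balanced_label m K g"
    "r * card (mismatch n g f) \<le> card (mismatch n h f)"
proof -
  let ?C = "mat n n (\<lambda>(i, j). a i j) * label_mat n K h"
  obtain g where Xg: "X = label_mat n K g" and g: "balanced_label m K g"
    using proj_label[OF X] unfolding n_def by blast
  have gK: "g i < K" and fK: "f i < K" if "i < n" for i
    using f g that by (auto simp: balanced_label_def n_def)
  have "(\<Sum>i<n. ?C $$ (i, f i)) \<le> (\<Sum>i<n. ?C $$ (i, g i))"
    unfolding n_def
    by (rule proj_sum_le) (use X f g Xg in \<open>auto simp: n_def\<close>)
  then have "(\<Sum>i<n. \<Sum>j<n. a i j * of_bool (h j = f i)) \<le>
      (\<Sum>i<n. \<Sum>j<n. a i j * of_bool (h j = g i))"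
    using gK fK by (simp add: mat_mult_label_index del: index_mult_mat)
  then have edges: "\<Gamma> * card (mismatch n g f) \<le>
      2 * (\<Sum>i\<in>mismatch n g f. \<Sum>j\<in>mismatch n h f. a i j)"
    by (intro ppm_step_mismatch_edges[OF nonneg gap gK]) auto
  have "r * card (mismatch n g f) \<le> card (mismatch n h f)"
  proof (rule ccontr)
    assume less: "\<not> ?thesis"
    then have "mismatch n g f \<noteq> {}" by auto
    with less have "2 * (\<Sum>i\<in>mismatch n g f. \<Sum>j\<in>mismatch n h f. a i j) <
        \<Gamma> * card (mismatch n g f)"
      by (intro sparse h) (auto simp: mismatch_def)
    with edges show False by simp
  qed
  with Xg g show ?thesis by (rule that)
qed

text \<open>Two facts are carried along the iterates: the mismatch stays within the proportion
  \<open>\<epsilon>\<close>, so that \<open>sparse\<close> remains applicable, and it shrinks by the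
  factor \<open>r\<close> in every step. After \<open>N\<close> steps its cardinality is at most
  \<open>n / r ^ N < 1\<close>, hence 0.\<close>

lemma ppm_outputs_subset:
  fixes a :: "nat \<Rightarrow> nat \<Rightarrow> real" and m n K :: nat and \<Gamma> \<epsilon> r :: real
  assumes n_def: "n = m * K"
    and nonneg: "\<And>i j. a i j \<ge> 0"
    and gap: "\<And>i k. i < n \<Longrightarrow> k < K \<Longrightarrow> k \<noteq> f i \<Longrightarrow>
      \<Gamma> \<le> (\<Sum>j<n. a i j * (of_bool (f j = f i) - of_bool (f j = k)))"
    and sparse: "\<And>S T. S \<subseteq> {..<n} \<Longrightarrow> T \<subseteq> {..<n} \<Longrightarrow> S \<noteq> {} \<Longrightarrow>
      real (card T) \<le> \<epsilon> * n \<Longrightarrow> real (card T) \<le> r * card S \<Longrightarrow>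
      2 * (\<Sum>i\<in>S. \<Sum>j\<in>T. a i j) < \<Gamma> * card S"
    and r: "1 \<le> r" "real n < r ^ N"
    and f: "balanced_label m K f"
    and h: "\<And>i. i < n \<Longrightarrow> h i < K" "2 * real (card (mismatch n h f)) \<le> \<epsilon> * n"
  shows "ppm_outputs m K (mat n n (\<lambda>(i, j). a i j)) N (label_mat n K h) \<subseteq> {label_mat n K f}"
proof
  fix Y assume "Y \<in> ppm_outputs m K (mat n n (\<lambda>(i, j). a i j)) N (label_mat n K h)"
  then obtain X where Y: "Y = X (N + 1)" and X1: "X 1 \<in> proj m K (label_mat n K h)"
    and XS: "\<And>k. k \<in> {1..N} \<Longrightarrow> X (k + 1) \<in> proj m K (mat n n (\<lambda>(i, j). a i j) * X k)"
    by (auto simp: ppm_outputs_def)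
  \<comment> \<open>\<open>X (k + 1)\<close> is the iterate after \<open>k\<close> power steps,
    \<open>X 1\<close> being the projection of the starting point. That projection may double the
    mismatch, which uses up the factor 2 in the hypothesis on \<open>h\<close>.\<close>
  have inv: "\<exists>g. X (k + 1) = label_mat n K g \<and> balanced_label m K g \<and>
      real (card (mismatch n g f)) \<le> \<epsilon> * n \<and> r ^ k * card (mismatch n g f) \<le> n"
    if "k \<le> N" for k
    using that
  proof (induction k)
    case 0
    obtain g where g: "X 1 = label_mat n K g" "balanced_label m K g"
      using proj_label[OF X1] unfolding n_def by blast
    have "card (mismatch n g f) \<le> 2 * card (mismatch n h f)"
      using proj_initial_mismatch[of m K g h f] X1 g f h(1) unfolding n_def by metis
    then have "real (card (mismatch n g f)) \<le> \<epsilon> * n"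
      using h(2) by linarith
    moreover have "card (mismatch n g f) \<le> card {..<n}"
      by (intro card_mono) (auto simp: mismatch_def)
    ultimately show ?case using g by auto
  next
    case (Suc k)
    then obtain g where g: "X (k + 1) = label_mat n K g" "balanced_label m K g"
      "real (card (mismatch n g f)) \<le> \<epsilon> * n" "r ^ k * card (mismatch n g f) \<le> n"
      by auto
    have "X (Suc k + 1) \<in> proj m K (mat n n (\<lambda>(i, j). a i j) * label_mat n K g)"
      using XS[of "k + 1"] Suc.prems g(1) by simp
    then obtain g' where g': "X (Suc k + 1) = label_mat n K g'" "balanced_label m K g'"
      "r * card (mismatch n g' f) \<le> card (mismatch n g f)"
      using ppm_step_contraction[OF n_def nonneg gap sparse f g(3)] by blast
    have "1 * real (card (mismatch n g' f)) \<le> r * card (mismatch n g' f)"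
      using r(1) by (intro mult_right_mono) auto
    then have "real (card (mismatch n g' f)) \<le> \<epsilon> * n"
      using g'(3) g(3) by linarith
    moreover have "r ^ Suc k * card (mismatch n g' f) \<le> n"
    proof -
      have "r ^ k * (r * card (mismatch n g' f)) \<le> r ^ k * card (mismatch n g f)"
        using r(1) by (intro mult_left_mono g'(3)) auto
      then show ?thesis using g(4) by (simp add: mult_ac)
    qed
    ultimately show ?case using g' by blast
  qed
  obtain g where g: "Y = label_mat n K g" "r ^ N * card (mismatch n g f) \<le> n"
    using inv[of N] Y by auto
  have "card (mismatch n g f) = 0"
  proof (rule ccontr)
    assume "card (mismatch n g f) \<noteq> 0"
    then have "1 \<le> real (card (mismatch n g f))" by linarith
    then have "r ^ N * 1 \<le> r ^ N * card (mismatch n g f)"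
      using r(1) by (intro mult_left_mono) auto
    then show False using g(2) r(2) by linarith
  qed
  then have "label_mat n K g = label_mat n K f"
    by (intro label_mat_cong) (auto simp: mismatch_def)
  then show "Y \<in> {label_mat n K f}" using g(1) by simp
qed

text \<open>The permutation attaining the minimum is absorbed into the true labelling. Twice the
  mismatch with the renamed labelling is the squared distance, at most
  \<open>\<theta>\<^sup>2 * n\<close>, and renaming the communities preserves the degree
  gaps.\<close>

lemma ppm_outputs_true_partitions:
  fixes a :: "nat \<Rightarrow> nat \<Rightarrow> real" and m n K :: nat and \<Gamma> \<epsilon> r :: real
  assumes n_def: "n = m * K"
    and nonneg: "\<And>i j. a i j \<ge> 0"
    and gap: "\<And>i k. i < n \<Longrightarrow> k < K \<Longrightarrow> k \<noteq> f i \<Longrightarrow>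
      \<Gamma> \<le> (\<Sum>j<n. a i j * (of_bool (f j = f i) - of_bool (f j = k)))"
    and sparse: "\<And>S T. S \<subseteq> {..<n} \<Longrightarrow> T \<subseteq> {..<n} \<Longrightarrow> S \<noteq> {} \<Longrightarrow>
      real (card T) \<le> \<epsilon> * n \<Longrightarrow> real (card T) \<le> r * card S \<Longrightarrow>
      2 * (\<Sum>i\<in>S. \<Sum>j\<in>T. a i j) < \<Gamma> * card S"
    and r: "1 \<le> r" "real n < r ^ N"
    and f: "balanced_label m K f"
    and H0: "H0 \<in> clustering_mats n K"
    and close: "(MIN Q\<in>perm_mats K. frob_norm (H0 - label_mat n K f * Q)) \<le> \<theta> * sqrt n"
    and \<theta>: "\<theta>\<^sup>2 \<le> \<epsilon>"
  shows "ppm_outputs m K (mat n n (\<lambda>(i, j). a i j)) N H0 \<subseteq> true_partitions K (label_mat n K f)"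
proof -
  have fK: "f i < K" if "i < n" for i
    using f that by (auto simp: balanced_label_def n_def)
  let ?D = "\<lambda>Q. frob_norm (H0 - label_mat n K f * Q)"
  have "Min (?D ` perm_mats K) \<in> ?D ` perm_mats K"
    using finite_perm_mats perm_mats_nonempty by (intro Min_in) auto
  then obtain Q where Q: "Q \<in> perm_mats K" "?D Q \<le> \<theta> * sqrt n"
    using close by auto
  then obtain \<pi> where \<pi>: "\<pi> permutes {..<K}"
    and Q\<pi>: "Q = mat K K (\<lambda>(i, j). if \<pi> i = j then 1 else 0)"
    by (auto simp: perm_mats_def)
  have fQ: "label_mat n K f * Q = label_mat n K (\<pi> \<circ> f)"
    unfolding Q\<pi> using \<pi> fK by (rule label_mat_mult_perm)
  obtain h where h: "H0 = label_mat n K h" "\<And>i. i < n \<Longrightarrow> h i < K"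
    using clustering_mats_label[OF H0] by blast
  have f': "balanced_label m K (\<pi> \<circ> f)"
    using \<pi> f by (rule balanced_label_permute)
  then have f'K: "(\<pi> \<circ> f) i < K" if "i < n" for i
    using that by (auto simp: balanced_label_def n_def)
  have "2 * real (card (mismatch n h (\<pi> \<circ> f))) = (?D Q)\<^sup>2"
    unfolding fQ h(1) using h(2) f'K by (simp add: frob_norm_label_mismatch)
  also have "\<dots> \<le> (\<theta> * sqrt n)\<^sup>2"
    using Q(2) by (intro power_mono) auto
  also have "\<dots> \<le> \<epsilon> * n"
    using \<theta> by (simp add: power_mult_distrib mult_right_mono)
  finally have mm: "2 * real (card (mismatch n h (\<pi> \<circ> f))) \<le> \<epsilon> * n" .
  have inj: "\<pi> x = \<pi> y \<longleftrightarrow> x = y" for x y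
    using permutes_inj[OF \<pi>] by (auto simp: inj_def)
  have gap': "\<Gamma> \<le> (\<Sum>j<n. a i j * (of_bool ((\<pi> \<circ> f) j = (\<pi> \<circ> f) i) - of_bool ((\<pi> \<circ> f) j = k)))"
    if ik: "i < n" "k < K" "k \<noteq> (\<pi> \<circ> f) i" for i k
  proof -
    obtain l where l: "l < K" "k = \<pi> l"
      using permutes_image[OF \<pi>] ik(2) by auto
    show ?thesis
      using gap[OF ik(1) l(1)] ik(3) l(2) by (simp add: inj)
  qed
  have out: "ppm_outputs m K (mat n n (\<lambda>(i, j). a i j)) N H0 \<subseteq> {label_mat n K (\<pi> \<circ> f)}"
    unfolding h(1) by (rule ppm_outputs_subset[OF n_def nonneg gap' sparse r f' h(2) mm])
  have "label_mat n K f * Q \<in> true_partitions K (label_mat n K f)"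
    using Q(1) by (auto simp: true_partitions_def)
  then have "label_mat n K (\<pi> \<circ> f) \<in> true_partitions K (label_mat n K f)"
    by (simp only: fQ)
  with out show ?thesis by (meson empty_subsetI insert_subset order_trans)
qed

section \<open>Chernoff bounds for weighted sums of independent indicators\<close>

text \<open>Exponential Markov inequality, with the Chernoff parameter absorbed into weights of
  arbitrary sign. Independence factorises the expectation, and each factor
  \<open>1 + p e * (exp (c e) - 1)\<close> is at most the exponential of its second summand.\<close>

lemma chernoff_Pi_bernoulli:
  fixes c p :: "'a \<Rightarrow> real"
  assumes E: "finite E" and p: "\<And>e. e \<in> E \<Longrightarrow> 0 \<le> p e \<and> p e \<le> 1"
  shows "measure_pmf.prob (Pi_pmf E False (\<lambda>e. bernoulli_pmf (p e)))
      {\<omega>. x \<le> (\<Sum>e\<in>E. c e * of_bool (\<omega> e))} \<le> exp (- x + (\<Sum>e\<in>E. p e * (exp (c e) - 1)))"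
proof -
  let ?M = "Pi_pmf E False (\<lambda>e. bernoulli_pmf (p e))"
  let ?u = "\<lambda>\<omega>. \<Prod>e\<in>E. exp (c e * of_bool (\<omega> e))"
  \<comment> \<open>Coordinates outside \<open>E\<close> are always \<open>False\<close>, so the
    support is finite and the exponential is integrable.\<close>
  have "set_pmf ?M \<subseteq> PiE_dflt E False (\<lambda>_. UNIV)"
    using E by (auto simp: set_Pi_pmf PiE_dflt_def)
  then have fin: "finite (set_pmf ?M)"
    by (rule finite_subset) (use E in \<open>auto intro: finite_PiE_dflt\<close>)
  have u: "?u \<omega> = exp (\<Sum>e\<in>E. c e * of_bool (\<omega> e))" for \<omega>
    by (simp only: exp_sum[OF E])
  have "measure_pmf.prob ?M {\<omega>. x \<le> (\<Sum>e\<in>E. c e * of_bool (\<omega> e))} =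
      measure_pmf.prob ?M {\<omega>\<in>space ?M. exp x \<le> ?u \<omega>}"
    unfolding u by simp
  also have "\<dots> \<le> measure_pmf.expectation ?M ?u / exp x"
    by (rule integral_Markov_inequality_measure[where A = "{}"])
       (auto intro!: integrable_measure_pmf_finite fin prod_nonneg)
  also have "measure_pmf.expectation ?M ?u =
      (\<Prod>e\<in>E. measure_pmf.expectation (bernoulli_pmf (p e)) (\<lambda>v. exp (c e * of_bool v)))"
    using E by (intro expectation_prod_Pi_pmf integrable_measure_pmf_finite) auto
  also have "\<dots> = (\<Prod>e\<in>E. 1 + p e * (exp (c e) - 1))"
    using p by (intro prod.cong) (auto simp: algebra_simps)
  also have "\<dots> \<le> (\<Prod>e\<in>E. exp (p e * (exp (c e) - 1)))"
  proof (intro prod_mono conjI)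
    fix e assume e: "e \<in> E"
    \<comment> \<open>A convex combination of 1 and \<open>exp (c e)\<close>, hence nonnegative even
      for a negative weight, as \<open>prod_mono\<close> requires.\<close>
    have "1 + p e * (exp (c e) - 1) = (1 - p e) + p e * exp (c e)"
      by (simp add: algebra_simps)
    also have "\<dots> \<ge> 0" using p[OF e] by auto
    finally show "0 \<le> 1 + p e * (exp (c e) - 1)" .
  qed (rule exp_ge_add_one_self)
  also have "\<dots> = exp (\<Sum>e\<in>E. p e * (exp (c e) - 1))"
    using E by (simp add: exp_sum)
  finally show ?thesis
    by (simp add: exp_diff divide_right_mono)
qed

text \<open>For sums indexed by something other than the edges, such as the vertices: injectivity
  transports the weights to \<open>E\<close>, where they are extended by 0.\<close>

lemma chernoff_Pi_bernoulli_reindex: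
  fixes d :: "'b \<Rightarrow> real" and p :: "'a \<Rightarrow> real"
  assumes E: "finite E" and p: "\<And>e. e \<in> E \<Longrightarrow> 0 \<le> p e \<and> p e \<le> 1"
    and \<phi>: "inj_on \<phi> J" "\<phi> ` J \<subseteq> E"
  shows "measure_pmf.prob (Pi_pmf E False (\<lambda>e. bernoulli_pmf (p e)))
      {\<omega>. x \<le> (\<Sum>j\<in>J. d j * of_bool (\<omega> (\<phi> j)))} \<le> exp (- x + (\<Sum>j\<in>J. p (\<phi> j) * (exp (d j) - 1)))"
proof -
  define c where "c = (\<lambda>e. if e \<in> \<phi> ` J then d (inv_into J \<phi> e) else 0)"
  \<comment> \<open>\<open>F\<close> stands for both the weighted sum and the exponent: each
    vanishes at weight 0, so edges outside the image drop out.\<close>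
  have sub: "(\<Sum>e\<in>E. F e (c e)) = (\<Sum>j\<in>J. F (\<phi> j) (d j))" if F: "\<And>e. F e 0 = 0"
    for F :: "'a \<Rightarrow> real \<Rightarrow> real"
  proof -
    have "(\<Sum>e\<in>E. F e (c e)) = (\<Sum>e\<in>\<phi> ` J. F e (c e))"
      using E \<phi>(2) F by (intro sum.mono_neutral_right) (auto simp: c_def)
    also have "\<dots> = (\<Sum>j\<in>J. F (\<phi> j) (d j))"
      using \<phi>(1) by (subst sum.reindex) (auto simp: c_def inv_into_f_f)
    finally show ?thesis .
  qed
  show ?thesis
    using chernoff_Pi_bernoulli[where p = p and c = c and x = x, OF E p]
      sub[of "\<lambda>e y. y * of_bool (_ e)"] sub[of "\<lambda>e y. p e * (exp y - 1)"]
    by simp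
qed

section \<open>Tail bounds for degree gaps and edge counts in the random graph\<close>

text \<open>The model before assembly of the matrix: the sample is the family of independent edge
  indicators to which the Chernoff bounds apply.\<close>

definition sbm_edges :: "nat \<Rightarrow> real \<Rightarrow> real \<Rightarrow> (nat \<Rightarrow> nat) \<Rightarrow> (nat \<times> nat \<Rightarrow> bool) pmf" where
  "sbm_edges n p q f = Pi_pmf {(i, j). i \<le> j \<and> j < n} False
     (\<lambda>(i, j). bernoulli_pmf (if f i = f j then p else q))"

definition adj :: "(nat \<times> nat \<Rightarrow> bool) \<Rightarrow> nat \<Rightarrow> nat \<Rightarrow> real" where
  "adj \<omega> i j = of_bool (\<omega> (min i j, max i j))"

lemma adj_nonneg: "0 \<le> adj \<omega> i j"
  by (simp add: adj_def)

lemma finite_edges: "finite {(i, j). i \<le> j \<and> j < (n::nat)}"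
  by (rule finite_subset[of _ "{..<n} \<times> {..<n}"]) auto

text \<open>Row \<open>i\<close> of a labelling matrix has its only 1 in column \<open>f i\<close>,
  so comparing that entry shows that equal rows mean equal labels.\<close>

lemma sbm_label_mat:
  assumes f: "\<And>i. i < n \<Longrightarrow> f i < K"
  shows "sbm n p q (label_mat n K f) =
    map_pmf (\<lambda>\<omega>. mat n n (\<lambda>(i, j). adj \<omega> i j)) (sbm_edges n p q f)"
proof -
  have row: "row (label_mat n K f) i = row (label_mat n K f) j \<longleftrightarrow> f i = f j" if "i < n" "j < n" for i j
  proof
    assume eq: "row (label_mat n K f) i = row (label_mat n K f) j"
    have "row (label_mat n K f) i $ f i = row (label_mat n K f) j $ f i" using eq by simp
    then show "f i = f j" using that f by (simp split: if_splits)
  qed (use that in \<open>auto intro!: eq_vecI\<close>)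
  show ?thesis
    unfolding sbm_def sbm_edges_def adj_def of_bool_def
    by (intro arg_cong[where f = "map_pmf _"] Pi_pmf_cong) (auto simp: row)
qed

lemma sbm_edges_eq:
  "sbm_edges n p q f = Pi_pmf {(i, j). i \<le> j \<and> j < n} False
     (\<lambda>e. bernoulli_pmf (if f (fst e) = f (snd e) then p else q))"
  by (simp add: sbm_edges_def case_prod_unfold)

text \<open>The pairs of \<open>i\<close> with distinct \<open>j\<close> are distinct as unordered
  pairs, hence independent. The Chernoff bound is applied with weight \<open>- lam\<close> on the
  community of \<open>i\<close> and \<open>lam\<close> on community \<open>k\<close>. Each
  contributes exactly \<open>m\<close> indicators, since the diagonal entry at \<open>i\<close> is
  present too.\<close>

lemma sbm_degree_gap_prob:
  fixes p q lam \<Gamma> :: real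
  assumes pq: "0 \<le> p" "p \<le> 1" "0 \<le> q" "q \<le> 1" and lam: "0 \<le> lam"
    and f: "balanced_label m K f" and ik: "i < m * K" "k < K" "k \<noteq> f i"
  shows "measure_pmf.prob (sbm_edges (m * K) p q f)
     {\<omega>. (\<Sum>j<m * K. adj \<omega> i j * (of_bool (f j = f i) - of_bool (f j = k))) \<le> \<Gamma>}
     \<le> exp (lam * \<Gamma> + m * p * (exp (- lam) - 1) + m * q * (exp lam - 1))"
proof -
  let ?n = "m * K"
  let ?p = "\<lambda>e. if f (fst e) = f (snd e) then p else q"
  define \<phi> where "\<phi> = (\<lambda>j. (min i j, max i j))"
  define d where "d = (\<lambda>j. - lam * (of_bool (f j = f i) - of_bool (f j = k)))"
  have inj: "inj_on \<phi> {..<?n}"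
    by (auto simp: inj_on_def \<phi>_def min_def max_def split: if_splits)
  have im: "\<phi> ` {..<?n} \<subseteq> {(i, j). i \<le> j \<and> j < ?n}"
    using ik by (auto simp: \<phi>_def)
  have cardf: "card {j. j < ?n \<and> f j = l} = m" if "l < K" for l
    using f that by (simp add: balanced_label_def)
  have fi: "f i < K" using f ik by (simp add: balanced_label_def)
  have p\<phi>: "?p (\<phi> j) = (if f j = f i then p else q)" for j
    by (auto simp: \<phi>_def min_def max_def)
  have "(\<Sum>j<?n. ?p (\<phi> j) * (exp (d j) - 1)) =
      (\<Sum>j<?n. (p * (exp (- lam) - 1)) * (if f j = f i then 1 else 0) +
        (q * (exp lam - 1)) * (if f j = k then 1 else 0))"
    unfolding p\<phi> using ik by (intro sum.cong) (auto simp: d_def)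
  also have "\<dots> = m * p * (exp (- lam) - 1) + m * q * (exp lam - 1)"
    by (simp only: sum.distrib sum_distrib_left[symmetric] sum_indicator_eq_card cardf[OF fi] cardf[OF ik(2)])
       simp
  finally have S: "(\<Sum>j<?n. ?p (\<phi> j) * (exp (d j) - 1)) = \<dots>" .
  \<comment> \<open>Multiplying by \<open>- lam\<close> turns the lower tail of the gap into an
    upper tail.\<close>
  have "{\<omega>. (\<Sum>j<?n. adj \<omega> i j * (of_bool (f j = f i) - of_bool (f j = k))) \<le> \<Gamma>}
      \<subseteq> {\<omega>. - lam * \<Gamma> \<le> (\<Sum>j<?n. d j * of_bool (\<omega> (\<phi> j)))}"
  proof safe
    fix \<omega> assume "(\<Sum>j<?n. adj \<omega> i j * (of_bool (f j = f i) - of_bool (f j = k))) \<le> \<Gamma>"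
    then have "- lam * \<Gamma> \<le> - lam * (\<Sum>j<?n. adj \<omega> i j * (of_bool (f j = f i) - of_bool (f j = k)))"
      using lam by (simp add: mult_left_mono)
    also have "\<dots> = (\<Sum>j<?n. d j * of_bool (\<omega> (\<phi> j)))"
      by (simp only: sum_distrib_left) (intro sum.cong, auto simp: d_def \<phi>_def adj_def)
    finally show "- lam * \<Gamma> \<le> (\<Sum>j<?n. d j * of_bool (\<omega> (\<phi> j)))" .
  qed
  then have "measure_pmf.prob (sbm_edges ?n p q f)
     {\<omega>. (\<Sum>j<?n. adj \<omega> i j * (of_bool (f j = f i) - of_bool (f j = k))) \<le> \<Gamma>} \<le>
     measure_pmf.prob (sbm_edges ?n p q f) {\<omega>. - lam * \<Gamma> \<le> (\<Sum>j<?n. d j * of_bool (\<omega> (\<phi> j)))}"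
    by (rule measure_pmf.finite_measure_mono) simp
  also have "\<dots> \<le> exp (- (- lam * \<Gamma>) + (\<Sum>j<?n. ?p (\<phi> j) * (exp (d j) - 1)))"
    unfolding sbm_edges_eq
    by (rule chernoff_Pi_bernoulli_reindex[OF finite_edges _ inj im]) (use pq in auto)
  finally show ?thesis unfolding S by (simp add: add_ac)
qed

text \<open>Convexity: \<open>exp\<close> lies below its chord between 0 and \<open>2 * lam\<close>.
  Only \<open>w = 1\<close> has content, and there the claim is
  \<open>(exp lam - 1)^2 >= 0\<close>.\<close>

lemma exp_mult_le_chord:
  fixes lam :: real and w :: nat
  assumes "w \<le> 2"
  shows "exp (lam * w) - 1 \<le> w * ((exp (2 * lam) - 1) / 2)"
proof -
  have "w = 0 \<or> w = 1 \<or> w = 2" using assms by auto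
  moreover have "exp lam - 1 \<le> (exp (2 * lam) - 1) / 2"
    using zero_le_power2[of "exp lam - 1"] exp_double[of lam] by (simp add: power2_eq_square algebra_simps)
  ultimately show ?thesis by (auto simp: mult.commute)
qed

text \<open>An unordered pair may be counted twice in \<open>S \<times> T\<close>, which is why \<open>exp (2 * lam)\<close> appears.\<close>

lemma sbm_edge_count_prob:
  fixes p q P lam x :: real
  assumes pq: "0 \<le> p" "p \<le> P" "0 \<le> q" "q \<le> P" "P \<le> 1" and lam: "0 \<le> lam"
    and S: "S \<subseteq> {..<n}" and T: "T \<subseteq> {..<n}"
  shows "measure_pmf.prob (sbm_edges n p q f) {\<omega>. x \<le> (\<Sum>i\<in>S. \<Sum>j\<in>T. adj \<omega> i j)}
     \<le> exp (- lam * x + P * (card S * card T) * (exp (2 * lam) / 2))"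
proof -
  let ?p = "\<lambda>e. if f (fst e) = f (snd e) then p else q"
  let ?E = "{(i, j). i \<le> j \<and> j < n}"
  define \<phi> :: "nat \<times> nat \<Rightarrow> nat \<times> nat" where "\<phi> = (\<lambda>(i, j). (min i j, max i j))"
  define w where "w = (\<lambda>e. card {x \<in> S \<times> T. \<phi> x = e})"
  have fin: "finite S" "finite T" using S T finite_subset by auto
  have im: "\<phi> ` (S \<times> T) \<subseteq> ?E" using S T by (auto simp: \<phi>_def)
  have w2: "w e \<le> 2" for e
  proof -
    have "{x \<in> S \<times> T. \<phi> x = e} \<subseteq> {(fst e, snd e), (snd e, fst e)}"
      by (auto simp: \<phi>_def min_def max_def split: if_splits)
    then have "w e \<le> card {(fst e, snd e), (snd e, fst e)}"
      unfolding w_def by (intro card_mono) auto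
    also have "\<dots> \<le> 2" by (simp add: card_insert_if)
    finally show ?thesis .
  qed
  have count: "(\<Sum>i\<in>S. \<Sum>j\<in>T. adj \<omega> i j) = (\<Sum>e\<in>?E. real (w e) * of_bool (\<omega> e))" for \<omega>
  proof -
    have "(\<Sum>i\<in>S. \<Sum>j\<in>T. adj \<omega> i j) = (\<Sum>x\<in>S \<times> T. of_bool (\<omega> (\<phi> x)))"
      by (auto simp: sum.cartesian_product adj_def \<phi>_def intro!: sum.cong)
    also have "\<dots> = (\<Sum>e\<in>?E. \<Sum>x\<in>{x \<in> S \<times> T. \<phi> x = e}. of_bool (\<omega> (\<phi> x)))"
      by (rule sum.group[symmetric]) (use fin im finite_edges in auto)
    also have "\<dots> = (\<Sum>e\<in>?E. real (w e) * of_bool (\<omega> e))"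
      by (intro sum.cong) (auto simp: w_def)
    finally show ?thesis .
  qed
  have "(\<Sum>e\<in>?E. w e) = (\<Sum>e\<in>?E. \<Sum>x\<in>{x \<in> S \<times> T. \<phi> x = e}. 1)"
    by (simp add: w_def)
  also have "\<dots> = (\<Sum>x\<in>S \<times> T. 1)"
    by (rule sum.group) (use fin im finite_edges in auto)
  finally have wsum: "(\<Sum>e\<in>?E. w e) = card S * card T"
    by (simp add: card_cartesian_product)
  have "{\<omega>. x \<le> (\<Sum>i\<in>S. \<Sum>j\<in>T. adj \<omega> i j)} \<subseteq>
      {\<omega>. lam * x \<le> (\<Sum>e\<in>?E. (lam * w e) * of_bool (\<omega> e))}"
    using lam by (auto simp: count mult.assoc sum_distrib_left[symmetric] intro: mult_left_mono)
  then have "measure_pmf.prob (sbm_edges n p q f) {\<omega>. x \<le> (\<Sum>i\<in>S. \<Sum>j\<in>T. adj \<omega> i j)} \<le>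
     measure_pmf.prob (sbm_edges n p q f) {\<omega>. lam * x \<le> (\<Sum>e\<in>?E. (lam * w e) * of_bool (\<omega> e))}"
    by (rule measure_pmf.finite_measure_mono) simp
  also have "\<dots> \<le> exp (- (lam * x) + (\<Sum>e\<in>?E. ?p e * (exp (lam * w e) - 1)))"
    unfolding sbm_edges_eq
    by (rule chernoff_Pi_bernoulli[OF finite_edges]) (use pq in auto)
  \<comment> \<open>The chord bound makes the exponent linear in the multiplicities
    \<open>w e\<close>, so only their total \<open>card S * card T\<close> matters.\<close>
  also have "(\<Sum>e\<in>?E. ?p e * (exp (lam * w e) - 1)) \<le> (\<Sum>e\<in>?E. P * (w e * (exp (2 * lam) / 2)))"
  proof (rule sum_mono)
    fix e
    have "exp (lam * w e) - 1 \<le> w e * ((exp (2 * lam) - 1) / 2)"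
      using w2 by (rule exp_mult_le_chord)
    also have "\<dots> \<le> w e * (exp (2 * lam) / 2)"
      by (intro mult_left_mono) auto
    finally show "?p e * (exp (lam * w e) - 1) \<le> P * (w e * (exp (2 * lam) / 2))"
      using pq lam by (intro mult_mono) auto
  qed
  also have "(\<Sum>e\<in>?E. P * (w e * (exp (2 * lam) / 2))) = P * real (\<Sum>e\<in>?E. w e) * (exp (2 * lam) / 2)"
    by (simp add: sum_distrib_left sum_distrib_right mult_ac)
  finally show ?thesis unfolding wsum by simp
qed

section \<open>Union bound over pairs of vertex sets\<close>

text \<open>There are \<open>card A choose k\<close> subsets of size \<open>k\<close>, so each size
  from 1 to \<open>card A\<close> contributes exactly 1. A union bound whose terms carry these
  weights thus costs only a factor \<open>card A\<close>.\<close>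

lemma sum_nonempty_subsets_inverse_binomial:
  assumes A: "finite A"
  shows "(\<Sum>S\<in>Pow A - {{}}. 1 / real (card A choose card S)) = real (card A)"
proof -
  have img: "card ` (Pow A - {{}}) \<subseteq> {1..card A}"
    using A by (auto simp: card_mono Suc_le_eq card_gt_0_iff finite_subset)
  have "(\<Sum>S\<in>Pow A - {{}}. 1 / real (card A choose card S)) =
      (\<Sum>k\<in>{1..card A}. \<Sum>S\<in>{S \<in> Pow A - {{}}. card S = k}. 1 / real (card A choose card S))"
    by (rule sum.group[symmetric]) (use A img in auto)
  also have "\<dots> = (\<Sum>k\<in>{1..card A}. 1)"
  proof (rule sum.cong[OF refl])
    fix k assume k: "k \<in> {1..card A}"
    then have "{S \<in> Pow A - {{}}. card S = k} = {S. S \<subseteq> A \<and> card S = k}" by auto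
    moreover have "0 < card A choose k" using k by (simp add: zero_less_binomial)
    ultimately show "(\<Sum>S\<in>{S \<in> Pow A - {{}}. card S = k}. 1 / real (card A choose card S)) = 1"
      using n_subsets[OF A, of k] by simp
  qed
  finally show ?thesis by simp
qed

lemma sum_times_scaled:
  fixes F G :: "_ \<Rightarrow> real"
  shows "(\<Sum>x\<in>A \<times> B. c * F (fst x) * G (snd x)) = c * sum F A * sum G B"
proof -
  have "c * sum F A * sum G B = (\<Sum>x\<in>A. \<Sum>y\<in>B. c * F x * G y)"
    unfolding sum_distrib_left[of c F A] sum_product by simp
  then show ?thesis by (simp add: sum.cartesian_product case_prod_unfold)
qed

text \<open>The term of index \<open>t\<close> in the expansion of \<open>(x + 1) ^ n\<close> at
  \<open>x = t / n\<close> is at most the whole sum, which is at most \<open>exp t\<close>.\<close>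

lemma binomial_le_exp:
  assumes "1 \<le> t" "t \<le> n"
  shows "real (n choose t) \<le> exp (t * (1 + ln (real n / t)))"
proof -
  define x where "x = real t / n"
  have x: "x > 0" and n: "n > 0" using assms by (auto simp: x_def)
  have "real (n choose t) * x ^ t \<le> (\<Sum>k\<le>n. real (n choose k) * x ^ k * 1 ^ (n - k))"
    using member_le_sum[of t "{..n}" "\<lambda>k. real (n choose k) * x ^ k * 1 ^ (n - k)"] assms x
    by simp
  also have "\<dots> = (x + 1) ^ n" by (rule binomial_ring[symmetric])
  also have "\<dots> \<le> exp x ^ n"
    using x exp_ge_add_one_self[of x] by (intro power_mono) (auto simp: add.commute)
  also have "\<dots> = exp t"
    using n by (simp add: exp_of_nat_mult[symmetric] x_def)
  finally have "real (n choose t) \<le> exp t / x ^ t"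
    using x by (simp add: pos_le_divide_eq)
  also have "\<dots> = exp t * (real n / t) ^ t"
    using assms n by (simp add: x_def power_divide)
  also have "(real n / t) ^ t = exp (t * ln (real n / t))"
    using assms n by (simp add: exp_of_nat_mult)
  finally show ?thesis by (simp add: exp_add[symmetric] distrib_left)
qed

text \<open>Put \<open>l = ln (n / t)\<close>. The choice \<open>exp (2 * lam) = n / t\<close> turns
  the Chernoff exponent into \<open>s * L * (\<alpha> / 2 - g * l / 4)\<close>. Per unit of
  \<open>s * L\<close>, half of \<open>g * l / 4\<close> absorbs the part of the cost of choosing
  \<open>T\<close> that grows with \<open>l\<close>. By smallness of \<open>t\<close> the other half
  is at least \<open>\<alpha> / 2 + 6\<close>, which covers \<open>\<alpha> / 2\<close>, the
  remaining cost 2 of the two choices, and the final \<open>- 4\<close>.\<close>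

lemma edge_count_union_exponent:
  fixes \<alpha> g L r :: real and n s t :: nat
  assumes L: "L = ln n" "1 \<le> L" and g: "0 < g" and \<alpha>: "0 \<le> \<alpha>"
    and r: "0 \<le> r" "r \<le> L" "8 * r \<le> g * L"
    and s: "1 \<le> s" "s \<le> n" and t: "1 \<le> t" "t \<le> n"
    and t_small: "real t \<le> exp (- ((4 * \<alpha> + 48) / g)) * n" and t_le: "real t \<le> r * s"
  defines "lam \<equiv> ln (real n / t) / 2"
  shows "exp (- lam * (g * L * s / 2) + (\<alpha> * L / n) * (s * t) * (exp (2 * lam) / 2))
    \<le> exp (- 4 * L) * (1 / real (n choose s)) * (1 / real (n choose t))"
proof -
  define l where "l = ln (real n / t)"
  have n: "0 < n" using t by simp
  have nt: "0 < real n / t" using t n by simp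
  have elam: "exp (2 * lam) = real n / t" using nt by (simp add: lam_def)
  have "exp ((4 * \<alpha> + 48) / g) * t \<le> n"
    using t_small by (simp add: exp_minus field_simps)
  then have "exp ((4 * \<alpha> + 48) / g) \<le> real n / t"
    using t by (simp add: pos_le_divide_eq)
  then have "(4 * \<alpha> + 48) / g \<le> l"
    using nt unfolding l_def by (simp add: ln_ge_iff)
  then have gl: "4 * \<alpha> + 48 \<le> g * l"
    using g by (simp add: pos_divide_le_eq mult.commute)
  then have "0 < g * l" using \<alpha> by linarith
  then have l: "0 < l" using g by (simp add: zero_less_mult_iff)
  \<comment> \<open>The crude bound \<open>n ^ s\<close> suffices for \<open>S\<close>. Since
    \<open>t\<close> may exceed \<open>s\<close> by a factor \<open>r\<close>, its binomial
    coefficient is instead measured against \<open>l\<close>.\<close>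
  have Cs: "real (n choose s) \<le> exp (s * L)"
  proof -
    have "real (n choose s) \<le> real n ^ s"
      using binomial_le_pow[OF s(2)] by (metis of_nat_le_iff of_nat_power)
    also have "\<dots> = exp (s * L)" using n by (simp add: L exp_of_nat_mult)
    finally show ?thesis .
  qed
  have Ct: "real (n choose t) \<le> exp (r * s * (1 + l))"
  proof -
    have "real (n choose t) \<le> exp (t * (1 + l))"
      using binomial_le_exp[OF t] by (simp add: l_def)
    also have "\<dots> \<le> exp (r * s * (1 + l))"
      using t_le l by (simp add: mult_right_mono)
    finally show ?thesis .
  qed
  have exponent: "- lam * (g * L * s / 2) + (\<alpha> * L / n) * (s * t) * (exp (2 * lam) / 2)
      = s * L * (- (g * l) / 4 + \<alpha> / 2)"
    unfolding elam using t n by (simp add: lam_def l_def field_simps)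
  \<comment> \<open>\<open>r <= L\<close> pays for the constant 1, and \<open>8 * r <= g * L\<close>
    for the summand \<open>l\<close>.\<close>
  have "r * s * (1 + l) \<le> s * L * (1 + g * l / 8)"
  proof -
    have "r * (1 + l) \<le> L + (g * L / 8) * l"
      using r l by (simp add: distrib_left add_mono mult_right_mono)
    then have "s * (r * (1 + l)) \<le> s * (L + (g * L / 8) * l)"
      by (intro mult_left_mono) auto
    then show ?thesis by (simp add: algebra_simps)
  qed
  then have "s * L * (- (g * l) / 4 + \<alpha> / 2) + s * L + r * s * (1 + l)
      \<le> s * L * (\<alpha> / 2 + 2 - g * l / 8)"
    by (simp add: algebra_simps)
  also have "\<dots> \<le> s * L * (- 4)"
    using gl L by (intro mult_left_mono) auto
  also have "\<dots> \<le> - 4 * L"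
    using mult_right_mono[of 1 "real s" L] s L(2) by simp
  finally have total: "s * L * (- (g * l) / 4 + \<alpha> / 2) + s * L + r * s * (1 + l) \<le> - 4 * L" .
  have pos: "0 < real (n choose s)" "0 < real (n choose t)"
    using s t by (simp_all add: zero_less_binomial)
  have "exp (s * L * (- (g * l) / 4 + \<alpha> / 2)) * (real (n choose s) * real (n choose t))
      \<le> exp (s * L * (- (g * l) / 4 + \<alpha> / 2)) * (exp (s * L) * exp (r * s * (1 + l)))"
    using Cs Ct pos by (intro mult_left_mono mult_mono) auto
  also have "\<dots> = exp (s * L * (- (g * l) / 4 + \<alpha> / 2) + s * L + r * s * (1 + l))"
    by (simp add: exp_add)
  also have "\<dots> \<le> exp (- 4 * L)" using total by simp
  finally show ?thesis
    unfolding exponent using pos by (simp add: pos_le_divide_eq mult.assoc)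
qed

text \<open>The event to be excluded: it negates the sparsity hypothesis of
  \<open>ppm_outputs_true_partitions\<close> at one pair of sets.\<close>

definition dense_pair :: "nat \<Rightarrow> real \<Rightarrow> real \<Rightarrow> real \<Rightarrow> (nat \<times> nat \<Rightarrow> bool) \<Rightarrow> nat set \<Rightarrow> nat set \<Rightarrow> bool" where
  "dense_pair n \<Gamma> \<epsilon> r \<omega> S T \<longleftrightarrow> S \<subseteq> {..<n} \<and> T \<subseteq> {..<n} \<and> S \<noteq> {} \<and>
     real (card T) \<le> \<epsilon> * n \<and> real (card T) \<le> r * card S \<and>
     \<Gamma> * card S \<le> 2 * (\<Sum>i\<in>S. \<Sum>j\<in>T. adj \<omega> i j)"

text \<open>Weighted union bound: a pair has probability at most \<open>exp (- 4 * L)\<close>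
  divided by its two binomial coefficients, the weights sum to \<open>n\<close> for each of the two
  sets, and \<open>n ^ 2 / n ^ 4\<close> remains.\<close>

lemma sbm_dense_pair_prob:
  fixes \<alpha> g L r p q :: real
  assumes L: "L = ln n" "1 \<le> L" and g: "0 < g" and \<alpha>: "0 \<le> \<alpha>"
    and r: "0 \<le> r" "r \<le> L" "8 * r \<le> g * L"
    and pq: "0 \<le> p" "p \<le> \<alpha> * L / n" "0 \<le> q" "q \<le> \<alpha> * L / n" "\<alpha> * L / n \<le> 1"
  defines "\<epsilon> \<equiv> exp (- ((4 * \<alpha> + 48) / g))"
  shows "measure_pmf.prob (sbm_edges n p q f) {\<omega>. \<exists>S T. dense_pair n (g * L) \<epsilon> r \<omega> S T} \<le> 1 / real n ^ 2"
proof -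
  let ?M = "sbm_edges n p q f"
  let ?P = "Pow {..<n} - {{}}"
  let ?C = "\<lambda>S. 1 / real (n choose card S)"
  have n: "0 < n" using L by (cases n) auto
  \<comment> \<open>An empty \<open>T\<close> carries no edges, while \<open>g * L * card S\<close>
    is positive. So only nonempty sets enter the sum, as the binomial estimates require.\<close>
  have T_ne: "T \<noteq> {}" if "dense_pair n (g * L) \<epsilon> r \<omega> S T" for \<omega> S T
  proof
    assume "T = {}"
    moreover have "0 < card S"
      using that finite_subset[of S "{..<n}"] by (auto simp: dense_pair_def card_gt_0_iff)
    then have "0 < g * L * card S" using g L by simp
    ultimately show False using that by (simp add: dense_pair_def)
  qed
  have pair: "measure_pmf.prob ?M {\<omega>. dense_pair n (g * L) \<epsilon> r \<omega> S T} \<le> exp (- 4 * L) * ?C S * ?C T"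
    if ST: "S \<in> ?P" "T \<in> ?P" for S T
  proof (cases "real (card T) \<le> \<epsilon> * n \<and> real (card T) \<le> r * card S")
    case False
    then have "{\<omega>. dense_pair n (g * L) \<epsilon> r \<omega> S T} = {}" by (auto simp: dense_pair_def)
    then show ?thesis by simp
  next
    case True
    have fin: "finite S" "finite T" using ST finite_subset by auto
    have s: "1 \<le> card S" "card S \<le> n" and t: "1 \<le> card T" "card T \<le> n"
      using ST fin card_mono[of "{..<n}"] by (auto simp: Suc_le_eq card_gt_0_iff)
    define lam where "lam = ln (real n / card T) / 2"
    have lam: "0 \<le> lam" using t by (simp add: lam_def)
    have "measure_pmf.prob ?M {\<omega>. dense_pair n (g * L) \<epsilon> r \<omega> S T} \<le>
        measure_pmf.prob ?M {\<omega>. g * L * card S / 2 \<le> (\<Sum>i\<in>S. \<Sum>j\<in>T. adj \<omega> i j)}"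
      by (rule measure_pmf.finite_measure_mono) (auto simp: dense_pair_def)
    also have "\<dots> \<le> exp (- lam * (g * L * card S / 2) +
        (\<alpha> * L / n) * (card S * card T) * (exp (2 * lam) / 2))"
      using sbm_edge_count_prob[OF pq lam, of S n T f "g * L * card S / 2"] ST by simp
    also have "\<dots> \<le> exp (- 4 * L) * ?C S * ?C T"
      unfolding lam_def using True
      by (intro edge_count_union_exponent[OF L g \<alpha> r s t]) (auto simp: \<epsilon>_def)
    finally show ?thesis .
  qed
  have "measure_pmf.prob ?M {\<omega>. \<exists>S T. dense_pair n (g * L) \<epsilon> r \<omega> S T} \<le>
      measure_pmf.prob ?M (\<Union>x\<in>?P \<times> ?P. {\<omega>. dense_pair n (g * L) \<epsilon> r \<omega> (fst x) (snd x)})"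
  proof (rule measure_pmf.finite_measure_mono)
    show "{\<omega>. \<exists>S T. dense_pair n (g * L) \<epsilon> r \<omega> S T} \<subseteq>
      (\<Union>x\<in>?P \<times> ?P. {\<omega>. dense_pair n (g * L) \<epsilon> r \<omega> (fst x) (snd x)})"
    proof safe
      fix \<omega> S T assume d: "dense_pair n (g * L) \<epsilon> r \<omega> S T"
      then have "(S, T) \<in> ?P \<times> ?P" using T_ne[OF d] by (auto simp: dense_pair_def)
      then show "\<omega> \<in> (\<Union>x\<in>?P \<times> ?P. {\<omega>. dense_pair n (g * L) \<epsilon> r \<omega> (fst x) (snd x)})"
        by (rule UN_I) (use d in simp)
    qed
  qed simp
  also have "\<dots> \<le> (\<Sum>x\<in>?P \<times> ?P. measure_pmf.prob ?M {\<omega>. dense_pair n (g * L) \<epsilon> r \<omega> (fst x) (snd x)})"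
    by (rule measure_pmf.finite_measure_subadditive_finite) auto
  also have "\<dots> \<le> (\<Sum>x\<in>?P \<times> ?P. exp (- 4 * L) * ?C (fst x) * ?C (snd x))"
    by (intro sum_mono pair) auto
  also have "\<dots> = exp (- 4 * L) * (\<Sum>S\<in>?P. ?C S) * (\<Sum>T\<in>?P. ?C T)"
    by (rule sum_times_scaled)
  also have "\<dots> = exp (- 4 * L) * n * n"
    using sum_nonempty_subsets_inverse_binomial[of "{..<n}"] by simp
  also have "exp (- 4 * L) = 1 / real n ^ 4"
  proof -
    have "exp (4 * L) = exp L ^ 4" by (simp add: exp_of_nat_mult[symmetric])
    then show ?thesis using n by (simp add: L exp_minus divide_inverse)
  qed
  also have "1 / real n ^ 4 * n * n = 1 / real n ^ 2"
    using n by (simp add: power2_eq_square power4_eq_xxxx)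
  finally show ?thesis by simp
qed

section \<open>Union bound over vertices and communities\<close>

text \<open>The non-strict inequality matches the Chernoff bound and still contains every failure of
  the gap hypothesis.\<close>

definition small_gap :: "nat \<Rightarrow> nat \<Rightarrow> (nat \<Rightarrow> nat) \<Rightarrow> real \<Rightarrow> (nat \<times> nat \<Rightarrow> bool) \<Rightarrow> nat \<Rightarrow> nat \<Rightarrow> bool" where
  "small_gap n K f \<Gamma> \<omega> i k \<longleftrightarrow> i < n \<and> k < K \<and> k \<noteq> f i \<and>
     (\<Sum>j<n. adj \<omega> i j * (of_bool (f j = f i) - of_bool (f j = k))) \<le> \<Gamma>"

lemma sbm_small_gap_prob:
  fixes p q lam \<Gamma> :: real
  assumes pq: "0 \<le> p" "p \<le> 1" "0 \<le> q" "q \<le> 1" and lam: "0 \<le> lam"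
    and f: "balanced_label m K f" and n: "n = m * K"
  shows "measure_pmf.prob (sbm_edges n p q f) {\<omega>. \<exists>i k. small_gap n K f \<Gamma> \<omega> i k}
     \<le> n * K * exp (lam * \<Gamma> + m * p * (exp (- lam) - 1) + m * q * (exp lam - 1))"
    (is "_ \<le> _ * ?B")
proof -
  let ?M = "sbm_edges n p q f"
  have pair: "measure_pmf.prob ?M {\<omega>. small_gap n K f \<Gamma> \<omega> i k} \<le> ?B" for i k
  proof (cases "i < n \<and> k < K \<and> k \<noteq> f i")
    case True
    then show ?thesis
      using sbm_degree_gap_prob[OF pq lam f, of i k \<Gamma>] by (simp add: small_gap_def n)
  next
    case False
    then have "{\<omega>. small_gap n K f \<Gamma> \<omega> i k} = {}" by (auto simp: small_gap_def)
    then show ?thesis by simp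
  qed
  have "{\<omega>. \<exists>i k. small_gap n K f \<Gamma> \<omega> i k} =
      (\<Union>x\<in>{..<n} \<times> {..<K}. {\<omega>. small_gap n K f \<Gamma> \<omega> (fst x) (snd x)})"
    by (auto simp: small_gap_def)
  then have "measure_pmf.prob ?M {\<omega>. \<exists>i k. small_gap n K f \<Gamma> \<omega> i k} \<le>
      (\<Sum>x\<in>{..<n} \<times> {..<K}. measure_pmf.prob ?M {\<omega>. small_gap n K f \<Gamma> \<omega> (fst x) (snd x)})"
    by (simp only:) (rule measure_pmf.finite_measure_subadditive_finite, auto)
  also have "\<dots> \<le> (\<Sum>x\<in>{..<n} \<times> {..<K}. ?B)"
    by (intro sum_mono pair)
  also have "\<dots> = n * K * ?B" by (simp add: card_cartesian_product)
  finally show ?thesis by simp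
qed

section \<open>Number of iterations and conclusion\<close>

text \<open>As \<open>ln (sqrt L) = ln L / 2\<close>, an exponent of \<open>2 * L / ln L\<close>
  already gives \<open>exp L = n\<close>; the summand 2 in the count contributes a further factor
  \<open>L > 1\<close> and makes the inequality strict.\<close>

lemma num_iterations_power:
  fixes n :: nat
  assumes "1 < ln (real n)"
  shows "real n < sqrt (ln n) ^ num_iterations n"
proof -
  define L where "L = ln (real n)"
  have L: "1 < L" "0 < ln L" using assms by (auto simp: L_def)
  have n: "0 < real n" using assms by (cases n) auto
  have "2 * L / ln L \<le> real (nat \<lceil>2 * L / ln L\<rceil>)" by (rule real_nat_ceiling_ge)
  then have "2 * L / ln L + 2 \<le> num_iterations n"
    unfolding num_iterations_def L_def by linarith
  then have "(2 * L / ln L + 2) * (ln L / 2) \<le> num_iterations n * (ln L / 2)"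
    using L by (intro mult_right_mono) auto
  moreover have "(2 * L / ln L + 2) * (ln L / 2) = L + ln L"
    using L by (simp add: field_simps)
  ultimately have "L < num_iterations n * (ln L / 2)"
    using L by linarith
  then have "exp L < exp (num_iterations n * (ln L / 2))" by simp
  also have "\<dots> = exp (ln L / 2) ^ num_iterations n" by (rule exp_of_nat_mult)
  also have "exp (ln L / 2) = sqrt L"
    using L by (simp add: ln_sqrt[symmetric])
  finally show ?thesis using n by (simp add: L_def)
qed

text \<open>The two exceptional events depend on the graph alone, so outside them the deterministic
  analysis covers all initial points and all choices of projections simultaneously.\<close>

lemma sbm_ppm_success_prob:
  fixes \<alpha> g L r p q lam \<theta> :: real and m n K :: nat
  assumes n: "n = m * K" and f: "balanced_label m K f"
    and L: "L = ln n" "1 < L" and g: "0 < g" and \<alpha>: "0 \<le> \<alpha>" and r: "8 * sqrt L \<le> g * L"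
    and pq: "0 \<le> p" "p \<le> \<alpha> * L / n" "0 \<le> q" "q \<le> \<alpha> * L / n" "\<alpha> * L / n \<le> 1" and lam: "0 \<le> lam"
    and \<theta>: "\<theta>\<^sup>2 \<le> exp (- ((4 * \<alpha> + 48) / g))"
  shows "measure_pmf.prob (sbm n p q (label_mat n K f))
      {A. \<forall>H0\<in>clustering_mats n K.
        (MIN Q\<in>perm_mats K. frob_norm (H0 - label_mat n K f * Q)) \<le> \<theta> * sqrt n \<longrightarrow>
        ppm_outputs m K A (num_iterations n) H0 \<subseteq> true_partitions K (label_mat n K f)}
    \<ge> 1 - (n * K * exp (lam * (g * L) + m * p * (exp (- lam) - 1) + m * q * (exp lam - 1)) + 1 / real n ^ 2)"
    (is "measure_pmf.prob _ ?good \<ge> 1 - (?b1 + ?b2)")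
proof -
  let ?M = "sbm_edges n p q f"
  let ?\<epsilon> = "exp (- ((4 * \<alpha> + 48) / g))"
  let ?gap = "{\<omega>. \<exists>i k. small_gap n K f (g * L) \<omega> i k}"
  let ?dense = "{\<omega>. \<exists>S T. dense_pair n (g * L) ?\<epsilon> (sqrt L) \<omega> S T}"
  let ?A = "\<lambda>\<omega>. mat n n (\<lambda>(i, j). adj \<omega> i j)"
  have fK: "f i < K" if "i < n" for i
    using f that by (simp add: balanced_label_def n)
  have sbm_eq: "sbm n p q (label_mat n K f) = map_pmf ?A ?M"
    by (rule sbm_label_mat) (rule fK)
  have sqrt_L: "1 \<le> sqrt L" "sqrt L \<le> L"
    using L real_sqrt_le_mono[of L "L * L"] by auto
  have "?A \<omega> \<in> ?good" if ok: "\<omega> \<notin> ?gap" "\<omega> \<notin> ?dense" for \<omega>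
  proof -
    have "ppm_outputs m K (?A \<omega>) (num_iterations n) H0 \<subseteq> true_partitions K (label_mat n K f)"
      if H0: "H0 \<in> clustering_mats n K"
        "(MIN Q\<in>perm_mats K. frob_norm (H0 - label_mat n K f * Q)) \<le> \<theta> * sqrt n" for H0
    proof (rule ppm_outputs_true_partitions[OF n adj_nonneg _ _ _ _ f H0 \<theta>])
      show "g * L \<le> (\<Sum>j<n. adj \<omega> i j * (of_bool (f j = f i) - of_bool (f j = k)))"
        if "i < n" "k < K" "k \<noteq> f i" for i k
      proof (rule ccontr)
        assume "\<not> ?thesis"
        then have "small_gap n K f (g * L) \<omega> i k"
          unfolding small_gap_def using that by (intro conjI) simp_all
        then show False using ok(1) by blast
      qed
      show "2 * (\<Sum>i\<in>S. \<Sum>j\<in>T. adj \<omega> i j) < g * L * card S"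
        if "S \<subseteq> {..<n}" "T \<subseteq> {..<n}" "S \<noteq> {}" "real (card T) \<le> ?\<epsilon> * n"
          "real (card T) \<le> sqrt L * card S" for S T
      proof (rule ccontr)
        assume "\<not> ?thesis"
        then have "dense_pair n (g * L) ?\<epsilon> (sqrt L) \<omega> S T"
          unfolding dense_pair_def using that by (intro conjI) simp_all
        then show False using ok(2) by blast
      qed
      show "1 \<le> sqrt L" by (rule sqrt_L)
      show "real n < sqrt L ^ num_iterations n"
        using num_iterations_power[of n] L by simp
    qed
    then show ?thesis by blast
  qed
  then have "- (?gap \<union> ?dense) \<subseteq> {\<omega>. ?A \<omega> \<in> ?good}" by blast
  then have "measure_pmf.prob ?M (- (?gap \<union> ?dense)) \<le> measure_pmf.prob ?M {\<omega>. ?A \<omega> \<in> ?good}"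
    by (rule measure_pmf.finite_measure_mono) simp
  moreover have "measure_pmf.prob ?M (- (?gap \<union> ?dense)) = 1 - measure_pmf.prob ?M (?gap \<union> ?dense)"
    using measure_pmf.prob_compl[of "?gap \<union> ?dense" ?M] by (simp add: Compl_eq_Diff_UNIV)
  moreover have "measure_pmf.prob ?M (?gap \<union> ?dense) \<le> measure_pmf.prob ?M ?gap + measure_pmf.prob ?M ?dense"
    by (rule measure_Un_le) auto
  moreover have p1: "p \<le> 1" and q1: "q \<le> 1" using pq by linarith+
  moreover have "measure_pmf.prob ?M ?gap \<le> ?b1"
    using sbm_small_gap_prob[OF pq(1) p1 pq(3) q1 lam f n, of "g * L"] by simp
  moreover have "measure_pmf.prob ?M ?dense \<le> ?b2"
    using sbm_dense_pair_prob[OF L(1) less_imp_le[OF L(2)] g \<alpha> _ sqrt_L(2) r pq] L(2) by simp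
  moreover have "measure_pmf.prob (sbm n p q (label_mat n K f)) ?good =
      measure_pmf.prob ?M {\<omega>. ?A \<omega> \<in> ?good}"
    by (simp only: sbm_eq measure_map_pmf vimage_def)
  ultimately show ?thesis by linarith
qed

theorem theorem1:
  fixes K :: nat and \<alpha> \<beta> :: real
  assumes "K \<ge> 2" and "\<alpha> > 0" and "\<beta> > 0"
    and "sqrt \<alpha> - sqrt \<beta> > sqrt (real K)"
  shows "\<exists>\<gamma>>0. \<exists>c>0. \<exists>n0 :: nat. \<forall>m n :: nat. \<forall>Hs :: real mat.
    m \<ge> 1 \<longrightarrow> n = m * K \<longrightarrow> n \<ge> n0 \<longrightarrow> Hs \<in> balanced_clustering_mats m K \<longrightarrow>
      measure_pmf.prob (sbm n (\<alpha> * ln (real n) / real n) (\<beta> * ln (real n) / real n) Hs)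
        {A. \<forall>H0 \<in> clustering_mats n K.
              (MIN Q\<in>perm_mats K. frob_norm (H0 - Hs * Q)) \<le> theta \<alpha> \<beta> K \<gamma> * sqrt (real n) \<longrightarrow>
              ppm_outputs m K A (num_iterations n) H0 \<subseteq> true_partitions K Hs}
      \<ge> 1 - real n powr (- c)"
proof -
  have K: "0 < real K" using assms(1) by simp
  define D where "D = (sqrt \<alpha> - sqrt \<beta>)\<^sup>2 / K"
  have "(sqrt (real K))\<^sup>2 < (sqrt \<alpha> - sqrt \<beta>)\<^sup>2"
    using assms(4) by (intro power_strict_mono) auto
  then have D: "1 < D" using K by (simp add: D_def)
  have "sqrt \<beta> < sqrt \<alpha>"
    using assms(4) real_sqrt_ge_zero[of "real K"] by linarith
  then have \<alpha>\<beta>: "\<beta> < \<alpha>" by simp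
  \<comment> \<open>The minimiser of \<open>\<alpha> * exp (- lam) + \<beta> * exp lam\<close>, at
    which both terms equal \<open>sqrt \<alpha> * sqrt \<beta>\<close>.\<close>
  define lam where "lam = ln (\<alpha> / \<beta>) / 2"
  have lam: "0 < lam" using assms \<alpha>\<beta> by (simp add: lam_def)
  have "exp lam = sqrt (\<alpha> / \<beta>)"
    using assms by (simp add: lam_def ln_sqrt[symmetric])
  then have exp_lam: "exp lam = sqrt \<alpha> / sqrt \<beta>" "exp (- lam) = sqrt \<beta> / sqrt \<alpha>"
    by (simp_all add: real_sqrt_divide exp_minus)
  \<comment> \<open>Demanding a gap of \<open>g * L\<close> costs
    \<open>lam * g = (D - 1) / 2\<close> in the exponent, half of its margin over 1.\<close>
  define g where "g = (D - 1) / (2 * lam)"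
  have g: "0 < g" using D lam by (simp add: g_def)
  define \<epsilon> where "\<epsilon> = exp (- ((4 * \<alpha> + 48) / g))"
  \<comment> \<open>Solves \<open>1 / 4 * (\<gamma> * sqrt K / (16 * (\<alpha> - \<beta>))) = sqrt
    \<epsilon>\<close>, so that \<open>theta\<close> is at most
    \<open>sqrt \<epsilon>\<close>.\<close>
  define \<gamma> where "\<gamma> = 64 * (\<alpha> - \<beta>) * sqrt \<epsilon> / sqrt K"
  have \<gamma>: "0 < \<gamma>" using \<alpha>\<beta> K by (simp add: \<gamma>_def \<epsilon>_def)
  have "theta \<alpha> \<beta> K \<gamma> \<le> 1 / 4 * (\<gamma> * sqrt K / (16 * (\<alpha> - \<beta>)))"
    unfolding theta_def by (intro mult_left_mono min.cobounded2) auto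
  also have "\<dots> = sqrt \<epsilon>"
    using \<alpha>\<beta> K by (simp add: \<gamma>_def)
  finally have "theta \<alpha> \<beta> K \<gamma> \<le> sqrt \<epsilon>" .
  moreover have "0 \<le> theta \<alpha> \<beta> K \<gamma>"
    using \<alpha>\<beta> K \<gamma> by (simp add: theta_def)
  ultimately have "(theta \<alpha> \<beta> K \<gamma>)\<^sup>2 \<le> (sqrt \<epsilon>)\<^sup>2"
    by (rule power_mono)
  then have \<theta>: "(theta \<alpha> \<beta> K \<gamma>)\<^sup>2 \<le> exp (- ((4 * \<alpha> + 48) / g))"
    by (simp add: \<epsilon>_def)
  \<comment> \<open>The two failure probabilities decay with exponents \<open>(D - 1) / 2\<close>
    and 2. Both are at least \<open>2 * c\<close>, and the spare factor \<open>n powr c\<close>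
    absorbs the constant \<open>K + 1\<close>.\<close>
  define c where "c = min ((D - 1) / 4) 1"
  have c: "0 < c" using D by (simp add: c_def)
  have c_le: "4 * c \<le> D - 1" "c \<le> 1" by (simp_all add: c_def min_def)
  have "\<forall>\<^sub>F n::nat in at_top. 1 < ln (real n)" by real_asymp
  moreover have "\<forall>\<^sub>F n::nat in at_top. 8 * sqrt (ln (real n)) \<le> g * ln (real n)"
    using g by real_asymp
  moreover have "\<forall>\<^sub>F n::nat in at_top. \<alpha> * ln (real n) / real n \<le> 1"
    using assms(2) by real_asymp
  moreover have "\<forall>\<^sub>F n::nat in at_top. real K + 1 \<le> real n powr c"
    using c by real_asymp
  ultimately have "\<forall>\<^sub>F n::nat in at_top. 1 < ln (real n) \<and> 8 * sqrt (ln (real n)) \<le> g * ln (real n) \<and>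
      \<alpha> * ln (real n) / real n \<le> 1 \<and> real K + 1 \<le> real n powr c"
    by eventually_elim simp
  \<comment> \<open>\<open>g\<close> and \<open>c\<close> are determined by \<open>\<alpha>\<close>,
    \<open>\<beta>\<close> and \<open>K\<close>, so the threshold depends on nothing else.\<close>
  then obtain n0 :: nat where n0: "\<And>n. n0 \<le> n \<Longrightarrow> 1 < ln (real n) \<and> 8 * sqrt (ln (real n)) \<le> g * ln (real n) \<and>
      \<alpha> * ln (real n) / real n \<le> 1 \<and> real K + 1 \<le> real n powr c"
    unfolding eventually_at_top_linorder by blast
  show ?thesis
  proof (rule exI[of _ \<gamma>], rule conjI[OF \<gamma>], rule exI[of _ c], rule conjI[OF c],
      rule exI[of _ n0], intro allI impI)
    fix m n :: nat and Hs :: "real mat"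
    assume n: "n = m * K" "n0 \<le> n" and Hs: "Hs \<in> balanced_clustering_mats m K"
    obtain f where Hsf: "Hs = label_mat n K f" and f: "balanced_label m K f"
      using balanced_clustering_mats_label[OF Hs] unfolding n(1) .
    define L where "L = ln (real n)"
    have large: "1 < L" "8 * sqrt L \<le> g * L" "\<alpha> * L / n \<le> 1" "real K + 1 \<le> real n powr c"
      using n0[OF n(2)] by (simp_all add: L_def)
    have n_pos: "1 < real n"
    proof (rule ccontr)
      assume "\<not> 1 < real n"
      then have "n = 0 \<or> n = 1" by auto
      then show False using large(1) by (auto simp: L_def)
    qed
    let ?p = "\<alpha> * L / n" and ?q = "\<beta> * L / n"
    have pq: "0 \<le> ?p" "?p \<le> \<alpha> * L / n" "0 \<le> ?q" "?q \<le> \<alpha> * L / n" "\<alpha> * L / n \<le> 1"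
      using assms \<alpha>\<beta> large n_pos by (auto intro!: divide_right_mono mult_right_mono)
    let ?good = "{A. \<forall>H0\<in>clustering_mats n K.
        (MIN Q\<in>perm_mats K. frob_norm (H0 - Hs * Q)) \<le> theta \<alpha> \<beta> K \<gamma> * sqrt n \<longrightarrow>
        ppm_outputs m K A (num_iterations n) H0 \<subseteq> true_partitions K Hs}"
    let ?b = "n * K * exp (lam * (g * L) + m * ?p * (exp (- lam) - 1) + m * ?q * (exp lam - 1)) + 1 / real n ^ 2"
    have prob: "measure_pmf.prob (sbm n ?p ?q Hs) ?good \<ge> 1 - ?b"
      unfolding Hsf
      by (rule sbm_ppm_success_prob[OF n(1) f L_def large(1) g less_imp_le[OF assms(2)] large(2) pq
            less_imp_le[OF lam] \<theta>])
    have mn: "real m / n = 1 / K"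
      using n(1) n_pos K by (cases m) (simp_all add: field_simps)
    have "lam * (g * L) + m * ?p * (exp (- lam) - 1) + m * ?q * (exp lam - 1) =
        L * (lam * g + real m / n * (\<alpha> * (exp (- lam) - 1) + \<beta> * (exp lam - 1)))"
      by (simp add: algebra_simps add_divide_distrib diff_divide_distrib)
    \<comment> \<open>The choice of \<open>lam\<close> completes the square here.\<close>
    also have "\<alpha> * (exp (- lam) - 1) + \<beta> * (exp lam - 1) = - ((sqrt \<alpha> - sqrt \<beta>)\<^sup>2)"
    proof -
      have "\<alpha> * (sqrt \<beta> / sqrt \<alpha>) = sqrt \<alpha> * sqrt \<beta>" "\<beta> * (sqrt \<alpha> / sqrt \<beta>) = sqrt \<alpha> * sqrt \<beta>"
        using assms(2,3) by (simp_all add: field_simps)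
      then show ?thesis
        using assms(2,3) unfolding exp_lam by (simp add: power2_eq_square algebra_simps)
    qed
    also have "L * (lam * g + real m / n * - ((sqrt \<alpha> - sqrt \<beta>)\<^sup>2)) = L * ((D - 1) / 2 - D)"
      unfolding mn using lam by (simp add: g_def D_def)
    also have "\<dots> = - (D - 1) / 2 * L - L"
      by (simp add: field_simps)
    finally have exponent: "lam * (g * L) + m * ?p * (exp (- lam) - 1) + m * ?q * (exp lam - 1) =
      - (D - 1) / 2 * L - L" .
    have "1 / real n ^ 2 = real n powr (- 2)"
      using n_pos by (simp add: powr_minus_divide powr_numeral)
    also have "\<dots> \<le> real n powr (- 2 * c)"
      using n_pos c_le(2) by (intro powr_mono) simp_all
    finally have dense: "1 / real n ^ 2 \<le> real n powr (- 2 * c)" .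
    \<comment> \<open>The summand \<open>- L\<close> in the exponent is the factor
      \<open>1 / n\<close> that cancels the number of vertices.\<close>
    have "n * K * exp (- (D - 1) / 2 * L - L) = K * real n powr (- (D - 1) / 2)"
      using n_pos by (simp add: exp_diff L_def powr_def)
    also have "\<dots> \<le> K * real n powr (- 2 * c)"
      using n_pos c_le(1) by (intro mult_left_mono powr_mono) simp_all
    finally have "?b \<le> (real K + 1) * real n powr (- 2 * c)"
      unfolding exponent using dense by (simp add: algebra_simps)
    also have "\<dots> \<le> real n powr c * real n powr (- 2 * c)"
      using large by (intro mult_right_mono) auto
    also have "\<dots> = real n powr (- c)"
      by (simp add: powr_add[symmetric])
    finally have "?b \<le> real n powr (- c)" .
    then show "measure_pmf.prob (sbm n (\<alpha> * ln (real n) / real n) (\<beta> * ln (real n) / real n) Hs) ?good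
        \<ge> 1 - real n powr (- c)"
      using prob unfolding L_def by linarith
  qed
qed

end
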